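(* Let $p$ be a non-constant real polynomial in one variable whose leading coefficient is positive. Then the set $$\Omega:=\{(u,v)\in\mathbb{R}^2 : 0<u<\infty,\ 0<v<e^{-p(u)}\}$$ is Schwartz equivalent to the one-sided infinite strip $S:=\{(x,y)\in\mathbb{R}^2 : 1<x<\infty,\ 0<y<1\}$, and also to the open unit disc $\mathbb{D}\subset\mathbb{R}^2$.
   Context: $\mathcal{S}(\mathbb{R}^n)$ is the usual Fréchet space of real-valued Schwartz functions on $\mathbb{R}^n$. For an open $U\subset\mathbb{R}^n$, $\mathcal{S}(U)$ is the closed subspace of those $f\in\mathcal{S}(\mathbb{R}^n)$ such that $f$ and all its partial derivatives vanish at every point of $\mathbb{R}^n\setminus U$, with the induced Fréchet topology; its elements are regarded (by restriction) as smooth functions on $U$. Two open subsets $U,V\subset\mathbb{R}^n$ are called Schwartz equivalent if there exists a $C^\infty$-diffeomorphism $\phi\colon U\to V$ such that $s\mapsto s\circ\phi$ is an isomorphism of Fréchet spaces $\mathcal{S}(V)\to\mathcal{S}(U)$. *)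

theory Defs
  imports "HOL-Analysis.Analysis" "HOL-Computational_Algebra.Polynomial"
begin

(* Iterated partial derivatives along the standard basis vectors listed in bs (the last one is
   taken first).  For a function differentiable at x, the Frechet derivative applied to the basis
   vector b is the partial derivative in direction b; where differentiability fails the value is
   unspecified, so this is only used together with smooth_on. *)
fun iter_partial ::
  "'a list \<Rightarrow> ('a::euclidean_space \<Rightarrow> 'b::real_normed_vector) \<Rightarrow> 'a \<Rightarrow> 'b" where
  "iter_partial [] f = f"
| "iter_partial (b # bs) f = (\<lambda>x. frechet_derivative (iter_partial bs f) (at x) b)"

(* C-infinity on an open set U; the values of f outside U are irrelevant. *)
definition smooth_on ::
  "'a::euclidean_space set \<Rightarrow> ('a \<Rightarrow> 'b::real_normed_vector) \<Rightarrow> bool" where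
  "smooth_on U f \<longleftrightarrow>
     (\<forall>bs. set bs \<subseteq> Basis \<longrightarrow> (\<forall>x\<in>U. iter_partial bs f differentiable (at x)))"

definition smooth_diffeomorphism ::
  "'a::euclidean_space set \<Rightarrow> 'b::euclidean_space set \<Rightarrow> ('a \<Rightarrow> 'b) \<Rightarrow> bool" where
  "smooth_diffeomorphism U V \<phi> \<longleftrightarrow>
     bij_betw \<phi> U V \<and> smooth_on U \<phi> \<and> smooth_on V (inv_into U \<phi>)"

definition schwartz_functions :: "('a::euclidean_space \<Rightarrow> real) set" where
  "schwartz_functions = {f. smooth_on UNIV f \<and>
     (\<forall>k bs. set bs \<subseteq> Basis \<longrightarrow> bounded (range (\<lambda>x. norm x ^ k * iter_partial bs f x)))}"

definition schwartz_seminorm ::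
  "nat \<Rightarrow> 'a list \<Rightarrow> ('a::euclidean_space \<Rightarrow> real) \<Rightarrow> real" where
  "schwartz_seminorm k bs f = (SUP x. norm x ^ k * \<bar>iter_partial bs f x\<bar>)"

definition schwartz_topology :: "('a::euclidean_space \<Rightarrow> real) topology" where
  "schwartz_topology = topology_generated_by
     {{g \<in> schwartz_functions. schwartz_seminorm k bs (\<lambda>x. g x - f x) < e} | f k bs e.
        f \<in> schwartz_functions \<and> set bs \<subseteq> Basis \<and> e > 0}"

definition schwartz_functions_on :: "'a::euclidean_space set \<Rightarrow> ('a \<Rightarrow> real) set" where
  "schwartz_functions_on U = {f \<in> schwartz_functions.
     \<forall>bs. set bs \<subseteq> Basis \<longrightarrow> (\<forall>x. x \<notin> U \<longrightarrow> iter_partial bs f x = 0)}"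

definition schwartz_topology_on :: "'a::euclidean_space set \<Rightarrow> ('a \<Rightarrow> real) topology" where
  "schwartz_topology_on U = subtopology schwartz_topology (schwartz_functions_on U)"

(* s o phi is only defined on U.  As elements of schwartz_functions_on U are functions on the
   whole space vanishing off U, its representative there is the extension by zero. *)
definition pullback ::
  "'a::euclidean_space set \<Rightarrow> ('a \<Rightarrow> 'a) \<Rightarrow> ('a \<Rightarrow> real) \<Rightarrow> 'a \<Rightarrow> real" where
  "pullback U \<phi> s = (\<lambda>x. if x \<in> U then s (\<phi> x) else 0)"

(* An isomorphism of Frechet spaces is a linear homeomorphism. *)
definition schwartz_space_isomorphism ::
  "'a::euclidean_space set \<Rightarrow> 'a set \<Rightarrow> (('a \<Rightarrow> real) \<Rightarrow> 'a \<Rightarrow> real) \<Rightarrow> bool" where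
  "schwartz_space_isomorphism V U T \<longleftrightarrow>
     (\<forall>s\<in>schwartz_functions_on V. \<forall>t\<in>schwartz_functions_on V.
        T (\<lambda>x. s x + t x) = (\<lambda>x. T s x + T t x)) \<and>
     (\<forall>c. \<forall>s\<in>schwartz_functions_on V. T (\<lambda>x. c * s x) = (\<lambda>x. c * T s x)) \<and>
     homeomorphic_map (schwartz_topology_on V) (schwartz_topology_on U) T"

definition schwartz_equivalent :: "'a::euclidean_space set \<Rightarrow> 'a set \<Rightarrow> bool" where
  "schwartz_equivalent U V \<longleftrightarrow> open U \<and> open V \<and>
     (\<exists>\<phi>. smooth_diffeomorphism U V \<phi> \<and> schwartz_space_isomorphism V U (pullback U \<phi>))"

end

(* Weigh a point x of a proper open set U by W(x) = 1 + |x| + 1 / dist(x, complement of U). By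
   Taylor's formula at the nearest boundary point, the elements of S(U) are exactly the functions
   on U all of whose derivatives decay faster than every power of 1/W. Hence a diffeomorphism
   whose derivatives, and those of its inverse, grow at most like powers of the weight, and which
   together with its inverse distorts the weights at most polynomially, induces an isomorphism of
   Schwartz spaces.

   With n = deg p, such a map from Omega to the strip is (u, v) |-> (exp((1+u)^n - 1), v e^p(u)):
   the thin end of Omega has distance about e^(-p(u)) to the boundary, so its weight is a power of
   the norm in the strip. The strip goes to a square by x |-> 2/x - 1, y |-> 2y - 1, and the square
   to the disc by an algebraic map. *)

theory Submission
  imports Defs
begin

text \<open>Straightening the cusp multiplies \<open>v\<close> by \<open>exp (poly p u)\<close>, and
  this factor has to be tempered on both sides. On the cusp, \<open>v * exp (poly p u) < 1\<close>
  bounds it by \<open>inverse v\<close>, which the weight dominates. On the strip neither horizontal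
  edge records it, so it must be bounded by a power of \<open>x\<close>; conversely \<open>x\<close>
  must be bounded by a power of it, for halfway up the thin end the weight of the cusp grows no
  faster. This fixes the first coordinate up to powers. Since only polynomial distortion of weights
  matters, no map has to extend to the boundary, and the corners of the square need no smoothing.
  Distances to the complement are never computed for the planar sets. Where a set is the source, an
  explicit outside point bounds the distance from above; where it is the target, every outside point
  violates a defining inequality, which bounds the distance from below.\<close>

section \<open>Tempered functions\<close>

text \<open>For \<open>U = UNIV\<close> the junk values \<open>infdist x {} = 0\<close> and \<open>inverse 0 = 0\<close> leave the
  weight \<open>1 + norm x\<close>.\<close>

definition boundary_weight :: "'a::euclidean_space set \<Rightarrow> 'a \<Rightarrow> real" where
  "boundary_weight U x = 1 + norm x + inverse (infdist x (- U))"

lemma boundary_weight_ge_1: "1 \<le> boundary_weight U x"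
  by (simp add: boundary_weight_def infdist_nonneg)

lemma boundary_weight_ge_norm: "norm x \<le> boundary_weight U x"
  by (simp add: boundary_weight_def infdist_nonneg add_nonneg_nonneg)

lemma infdist_compl_pos:
  assumes "open U" "U \<noteq> UNIV" "x \<in> U"
  shows "0 < infdist x (- U)"
  using assms by (intro infdist_pos_not_in_closed) auto

lemma inverse_le_boundary_weight:
  assumes "open U" "x \<in> U" "z \<notin> U" "dist x z \<le> d"
  shows "inverse d \<le> boundary_weight U x"
proof -
  have "0 < infdist x (- U)" using infdist_compl_pos assms by blast
  moreover have "infdist x (- U) \<le> d" using assms infdist_le2[of z "- U" x d] by simp
  ultimately have "inverse d \<le> inverse (infdist x (- U))" by (simp add: le_imp_inverse_le)
  then show ?thesis unfolding boundary_weight_def using norm_ge_zero[of x] by linarith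
qed

definition tempered :: "'a::euclidean_space set \<Rightarrow> ('a \<Rightarrow> real) \<Rightarrow> bool" where
  "tempered U h \<longleftrightarrow> (\<exists>C k. \<forall>x\<in>U. \<bar>h x\<bar> \<le> C * boundary_weight U x ^ k)"

lemma temperedI: "(\<And>x. x \<in> U \<Longrightarrow> \<bar>h x\<bar> \<le> C * boundary_weight U x ^ k) \<Longrightarrow> tempered U h"
  unfolding tempered_def by blast

lemma temperedE:
  assumes "tempered U h"
  obtains C k where "0 \<le> C" "\<And>x. x \<in> U \<Longrightarrow> \<bar>h x\<bar> \<le> C * boundary_weight U x ^ k"
proof -
  obtain C k where *: "\<And>x. x \<in> U \<Longrightarrow> \<bar>h x\<bar> \<le> C * boundary_weight U x ^ k"
    using assms unfolding tempered_def by blast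
  have "\<bar>h x\<bar> \<le> \<bar>C\<bar> * boundary_weight U x ^ k" if "x \<in> U" for x
    using *[OF that] boundary_weight_ge_1[of U x]
    by (smt (verit) mult_right_mono zero_le_power)
  then show ?thesis using that[of "\<bar>C\<bar>"] by auto
qed

lemma tempered_mono:
  assumes "tempered U g" "\<And>x. x \<in> U \<Longrightarrow> \<bar>f x\<bar> \<le> \<bar>g x\<bar>"
  shows "tempered U f"
  using assms unfolding tempered_def by (meson order_trans)

lemma tempered_cong: "(\<And>x. x \<in> U \<Longrightarrow> f x = g x) \<Longrightarrow> tempered U f \<longleftrightarrow> tempered U g"
  unfolding tempered_def by simp

lemma tempered_const: "tempered U (\<lambda>x. c)"
  by (rule temperedI[where C="\<bar>c\<bar>" and k=0]) simp

lemma tempered_weight: "tempered U (boundary_weight U)"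
  using boundary_weight_ge_1[of U] by (intro temperedI[where C=1 and k=1]) (smt (verit) power_one_right)

lemma tempered_add:
  assumes "tempered U f" "tempered U g"
  shows "tempered U (\<lambda>x. f x + g x)"
proof -
  obtain C k where C: "0 \<le> C" "\<And>x. x \<in> U \<Longrightarrow> \<bar>f x\<bar> \<le> C * boundary_weight U x ^ k"
    using temperedE assms(1) by blast
  obtain C' k' where C': "0 \<le> C'" "\<And>x. x \<in> U \<Longrightarrow> \<bar>g x\<bar> \<le> C' * boundary_weight U x ^ k'"
    using temperedE assms(2) by blast
  show ?thesis
  proof (rule temperedI[where C="C+C'" and k="k+k'"])
    fix x assume x: "x \<in> U"
    have "C * boundary_weight U x ^ k \<le> C * boundary_weight U x ^ (k+k')"
         "C' * boundary_weight U x ^ k' \<le> C' * boundary_weight U x ^ (k+k')"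
      using C(1) C'(1) boundary_weight_ge_1[of U x]
      by (auto intro!: mult_left_mono power_increasing)
    then show "\<bar>f x + g x\<bar> \<le> (C + C') * boundary_weight U x ^ (k + k')"
      using C(2)[OF x] C'(2)[OF x] by (simp add: distrib_right)
  qed
qed

lemma tempered_mult:
  assumes "tempered U f" "tempered U g"
  shows "tempered U (\<lambda>x. f x * g x)"
proof -
  obtain C k where C: "0 \<le> C" "\<And>x. x \<in> U \<Longrightarrow> \<bar>f x\<bar> \<le> C * boundary_weight U x ^ k"
    using temperedE assms(1) by blast
  obtain C' k' where C': "0 \<le> C'" "\<And>x. x \<in> U \<Longrightarrow> \<bar>g x\<bar> \<le> C' * boundary_weight U x ^ k'"
    using temperedE assms(2) by blast
  show ?thesis
  proof (rule temperedI[where C="C*C'" and k="k+k'"])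
    fix x assume x: "x \<in> U"
    have "\<bar>f x\<bar> * \<bar>g x\<bar> \<le> (C * boundary_weight U x ^ k) * (C' * boundary_weight U x ^ k')"
      using C(2)[OF x] C'(2)[OF x] by (intro mult_mono) auto
    then show "\<bar>f x * g x\<bar> \<le> (C * C') * boundary_weight U x ^ (k + k')"
      by (simp add: abs_mult power_add mult_ac)
  qed
qed

lemma tempered_power: "tempered U f \<Longrightarrow> tempered U (\<lambda>x. f x ^ k)"
  by (induction k) (auto intro: tempered_const tempered_mult)

lemma tempered_compose:
  assumes "tempered V h" "tempered U (\<lambda>x. boundary_weight V (\<phi> x))" "\<And>x. x \<in> U \<Longrightarrow> \<phi> x \<in> V"
  shows "tempered U (\<lambda>x. h (\<phi> x))"
proof -
  obtain C k where C: "0 \<le> C" "\<And>x. x \<in> V \<Longrightarrow> \<bar>h x\<bar> \<le> C * boundary_weight V x ^ k"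
    using temperedE assms(1) by blast
  have "tempered U (\<lambda>x. C * boundary_weight V (\<phi> x) ^ k)"
    using assms(2) by (intro tempered_mult tempered_const tempered_power)
  then show ?thesis by (rule tempered_mono) (use C assms(3) in \<open>force intro: order_trans\<close>)
qed

section \<open>Calculus of estimates for all partial derivatives\<close>

text \<open>All partial derivatives up to a given order exist and obey the estimate \<open>Q\<close>. The estimate
  concerns a family indexed by \<open>I\<close>: taking \<open>I\<close> to be a space of Schwartz functions, it
  can assert bounds by seminorms of the index, which is what continuity of the pullback requires.\<close>

primrec diff_estimate ::
  "(('i \<Rightarrow> 'a::euclidean_space \<Rightarrow> real) \<Rightarrow> bool) \<Rightarrow> 'i set \<Rightarrow> 'a set \<Rightarrow> nat \<Rightarrow>
   ('i \<Rightarrow> 'a \<Rightarrow> real) \<Rightarrow> bool" where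
  "diff_estimate Q I U 0 f \<longleftrightarrow> Q f"
| "diff_estimate Q I U (Suc m) f \<longleftrightarrow> Q f \<and>
     (\<exists>D. (\<forall>i\<in>I. \<forall>x\<in>U. (f i has_derivative D i x) (at x)) \<and>
          (\<forall>b\<in>Basis. diff_estimate Q I U m (\<lambda>i x. D i x b)))"

lemma diff_estimate_order_0: "diff_estimate Q I U m f \<Longrightarrow> Q f"
  by (cases m) auto

lemma diff_estimate_SucI:
  assumes "Q f" "\<And>i x. i \<in> I \<Longrightarrow> x \<in> U \<Longrightarrow> (f i has_derivative D i x) (at x)"
    "\<And>b. b \<in> Basis \<Longrightarrow> diff_estimate Q I U m (\<lambda>i x. D i x b)"
  shows "diff_estimate Q I U (Suc m) f"
  using assms by auto

lemma diff_estimate_SucE: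
  assumes "diff_estimate Q I U (Suc m) f"
  obtains D where "Q f" "\<And>i x. i \<in> I \<Longrightarrow> x \<in> U \<Longrightarrow> (f i has_derivative D i x) (at x)"
    "\<And>b. b \<in> Basis \<Longrightarrow> diff_estimate Q I U m (\<lambda>i x. D i x b)"
  using assms by auto

lemma diff_estimate_SucD: "diff_estimate Q I U (Suc m) f \<Longrightarrow> diff_estimate Q I U m f"
proof (induction m arbitrary: f)
  case (Suc m)
  show ?case by (rule diff_estimate_SucE[OF Suc.prems], rule diff_estimate_SucI) (auto intro: Suc.IH)
qed simp

text \<open>A single function is treated as a family indexed by \<open>{()}\<close>, so that one
  calculus of families serves both the tempered coefficients and the Schwartz functions that they
  multiply.\<close>

abbreviation tempered_order :: "'a::euclidean_space set \<Rightarrow> nat \<Rightarrow> ('a \<Rightarrow> real) \<Rightarrow> bool" where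
  "tempered_order U m h \<equiv> diff_estimate (\<lambda>f. tempered U (f ())) {()} U m (\<lambda>_. h)"

lemma tempered_order_SucI:
  assumes "tempered U h" "\<And>x. x \<in> U \<Longrightarrow> (h has_derivative D x) (at x)"
    "\<And>b. b \<in> Basis \<Longrightarrow> tempered_order U m (\<lambda>x. D x b)"
  shows "tempered_order U (Suc m) h"
  by (rule diff_estimate_SucI[where D="\<lambda>_. D"]) (use assms in auto)

lemma tempered_order_SucE:
  assumes "tempered_order U (Suc m) h"
  obtains D where "tempered U h" "\<And>x. x \<in> U \<Longrightarrow> (h has_derivative D x) (at x)"
    "\<And>b. b \<in> Basis \<Longrightarrow> tempered_order U m (\<lambda>x. D x b)"
proof -
  obtain D :: "unit \<Rightarrow> 'a \<Rightarrow> 'a \<Rightarrow> real" where D: "tempered U h"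
    "\<And>i x. i \<in> {()} \<Longrightarrow> x \<in> U \<Longrightarrow> (h has_derivative D i x) (at x)"
    "\<And>b. b \<in> Basis \<Longrightarrow> diff_estimate (\<lambda>f. tempered U (f ())) {()} U m (\<lambda>i x. D i x b)"
    using assms by (rule diff_estimate_SucE) blast
  have "(\<lambda>i x. D i x b) = (\<lambda>_ x. D () x b)" for b by (intro ext) (metis old.unit.exhaust)
  then show thesis using that[of "D ()"] D by auto
qed

text \<open>The conditions make the families satisfying \<open>Q\<close> a module over the tempered
  functions that sees only values on \<open>U\<close>, which is what the product and chain rules
  require. The two instances are temperedness itself and rapid decay with bounds by
  seminorms.\<close>

locale estimate =
  fixes U :: "'a::euclidean_space set" and I :: "'i set" and Q :: "('i \<Rightarrow> 'a \<Rightarrow> real) \<Rightarrow> bool"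
  assumes Q_zero: "Q (\<lambda>i x. 0)"
    and Q_add: "Q f \<Longrightarrow> Q g \<Longrightarrow> Q (\<lambda>i x. f i x + g i x)"
    and Q_mult: "Q f \<Longrightarrow> tempered U h \<Longrightarrow> Q (\<lambda>i x. f i x * h x)"
    and Q_cong: "(\<And>i x. i \<in> I \<Longrightarrow> x \<in> U \<Longrightarrow> f i x = g i x) \<Longrightarrow> Q f \<Longrightarrow> Q g"
begin

abbreviation "est \<equiv> diff_estimate Q I U"

lemma est_zero: "est m (\<lambda>i x. 0)"
proof (induction m)
  case (Suc m)
  then show ?case by (intro diff_estimate_SucI[where D="\<lambda>_ _ _. 0"]) (auto simp: Q_zero)
qed (simp add: Q_zero)

lemma est_add: "est m f \<Longrightarrow> est m g \<Longrightarrow> est m (\<lambda>i x. f i x + g i x)"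
proof (induction m arbitrary: f g)
  case (Suc m)
  obtain D where D: "Q f" "\<And>i x. i \<in> I \<Longrightarrow> x \<in> U \<Longrightarrow> (f i has_derivative D i x) (at x)"
    "\<And>b. b \<in> Basis \<Longrightarrow> est m (\<lambda>i x. D i x b)"
    using Suc.prems(1) by (rule diff_estimate_SucE) blast
  obtain E where E: "Q g" "\<And>i x. i \<in> I \<Longrightarrow> x \<in> U \<Longrightarrow> (g i has_derivative E i x) (at x)"
    "\<And>b. b \<in> Basis \<Longrightarrow> est m (\<lambda>i x. E i x b)"
    using Suc.prems(2) by (rule diff_estimate_SucE) blast
  show ?case
    by (rule diff_estimate_SucI[where D="\<lambda>i x h. D i x h + E i x h"])
      (use D E Suc.IH in \<open>auto intro: Q_add has_derivative_add\<close>)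
qed (simp add: Q_add)

lemma est_mult: "est m f \<Longrightarrow> tempered_order U m h \<Longrightarrow> est m (\<lambda>i x. f i x * h x)"
proof (induction m arbitrary: f h)
  case (Suc m)
  obtain D where D: "Q f" "\<And>i x. i \<in> I \<Longrightarrow> x \<in> U \<Longrightarrow> (f i has_derivative D i x) (at x)"
    "\<And>b. b \<in> Basis \<Longrightarrow> est m (\<lambda>i x. D i x b)"
    using Suc.prems(1) by (rule diff_estimate_SucE) blast
  obtain E where E: "tempered U h" "\<And>x. x \<in> U \<Longrightarrow> (h has_derivative E x) (at x)"
    "\<And>b. b \<in> Basis \<Longrightarrow> tempered_order U m (\<lambda>x. E x b)"
    using Suc.prems(2) by (rule tempered_order_SucE) blast
  show ?case
  proof (rule diff_estimate_SucI[where D="\<lambda>i x b. f i x * E x b + D i x b * h x"])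
    fix b :: 'a assume b: "b \<in> Basis"
    show "est m (\<lambda>i x. f i x * E x b + D i x b * h x)"
      \<comment> \<open>In each term of the product rule the undifferentiated factor is lowered by
        one order to match the differentiated one.\<close>
      using Suc.IH[OF diff_estimate_SucD[OF Suc.prems(1)] E(3)[OF b]]
        Suc.IH[OF D(3)[OF b] diff_estimate_SucD[OF Suc.prems(2)]] by (rule est_add)
  qed (use D E in \<open>auto intro: Q_mult has_derivative_mult\<close>)
qed (simp add: Q_mult)

lemma est_cong:
  assumes "open U" "\<And>i x. i \<in> I \<Longrightarrow> x \<in> U \<Longrightarrow> f i x = g i x" "est m f"
  shows "est m g"
proof (cases m)
  case 0
  then show ?thesis using assms Q_cong by auto
next
  case (Suc n)
  obtain D where D: "Q f" "\<And>i x. i \<in> I \<Longrightarrow> x \<in> U \<Longrightarrow> (f i has_derivative D i x) (at x)"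
    "\<And>b. b \<in> Basis \<Longrightarrow> est n (\<lambda>i x. D i x b)"
    using assms(3) unfolding Suc by (rule diff_estimate_SucE) blast
  show ?thesis unfolding Suc
  proof (rule diff_estimate_SucI[where D=D])
    show "Q g" using D(1) assms(2) by (rule Q_cong[rotated])
    show "(g i has_derivative D i x) (at x)" if "i \<in> I" "x \<in> U" for i x
      by (rule has_derivative_transform_within_open[OF D(2)[OF that] assms(1)])
        (use that assms in auto)
  qed (use D in auto)
qed

lemma est_sum: "(\<And>j. j \<in> A \<Longrightarrow> est m (f j)) \<Longrightarrow> est m (\<lambda>i x. \<Sum>j\<in>A. f j i x)"
  by (induction A rule: infinite_finite_induct) (auto intro: est_zero est_add)

text \<open>Bridge from the existential derivatives of \<open>diff_estimate\<close> to
  \<open>iter_partial\<close>: derivatives at points of \<open>U\<close> are unique, so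
  \<open>D i x b\<close> is the iterated partial. Each differentiation uses up one order, hence the
  premise at all orders.\<close>

lemma est_iter_partial:
  assumes "open U" "\<And>m. est m f" "set bs \<subseteq> Basis"
  shows "est m (\<lambda>i. iter_partial bs (f i))"
    and "i \<in> I \<Longrightarrow> x \<in> U \<Longrightarrow> iter_partial bs (f i) differentiable (at x)"
proof -
  have *: "est m (\<lambda>i. iter_partial bs (f i))" for m
    using assms(3)
  proof (induction bs arbitrary: m)
    case (Cons b bs)
    have "est (Suc m) (\<lambda>i. iter_partial bs (f i))" 
      using Cons.prems by (intro Cons.IH) auto
    then obtain D where D: "Q (\<lambda>i. iter_partial bs (f i))"
      "\<And>i x. i \<in> I \<Longrightarrow> x \<in> U \<Longrightarrow> (iter_partial bs (f i) has_derivative D i x) (at x)"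
      "\<And>b. b \<in> Basis \<Longrightarrow> est m (\<lambda>i x. D i x b)"
      by (rule diff_estimate_SucE) blast
    have "D i x b = iter_partial (b # bs) (f i) x" if "i \<in> I" "x \<in> U" for i x
      using frechet_derivative_at[OF D(2)[OF that]] by simp
    then show ?case
      by (rule est_cong[OF assms(1)]) (use D(3) Cons.prems in auto)
  qed (use assms in simp)
  show "est m (\<lambda>i. iter_partial bs (f i))" by (rule *)
  show "iter_partial bs (f i) differentiable (at x)" if "i \<in> I" "x \<in> U"
    using *[of 1] that unfolding differentiable_def by auto
qed

text \<open>The converse bridge: Frechet derivatives of the iterated partials serve as witnesses at
  every order.\<close>

lemma est_if_iter_partial:
  assumes "\<And>bs i x. set bs \<subseteq> Basis \<Longrightarrow> i \<in> I \<Longrightarrow> x \<in> U \<Longrightarrow> iter_partial bs (f i) differentiable (at x)"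
    and "\<And>bs. set bs \<subseteq> Basis \<Longrightarrow> Q (\<lambda>i. iter_partial bs (f i))"
  shows "est m f"
proof -
  have "est m (\<lambda>i. iter_partial bs (f i))" if "set bs \<subseteq> Basis" for bs
    using that
  proof (induction m arbitrary: bs)
    case (Suc m)
    show ?case
    proof (rule diff_estimate_SucI[where D="\<lambda>i x. frechet_derivative (iter_partial bs (f i)) (at x)"])
      show "est m (\<lambda>i x. frechet_derivative (iter_partial bs (f i)) (at x) b)" if "b \<in> Basis" for b
        using Suc.IH[of "b # bs"] Suc.prems that by simp
    qed (use Suc.prems assms in \<open>auto simp: frechet_derivative_works[symmetric]\<close>)
  qed (use assms in simp)
  from this[of "[]"] show ?thesis by simp
qed

end

interpretation tempered: estimate U "{()}" "\<lambda>f. tempered U (f ())" for U :: "'a::euclidean_space set"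
proof
  show "tempered U (f ()) \<Longrightarrow> tempered U (g ())"
    if "\<And>i x. i \<in> {()} \<Longrightarrow> x \<in> U \<Longrightarrow> f i x = g i x" for f g :: "unit \<Rightarrow> 'a \<Rightarrow> real"
    using that tempered_cong[of U "f ()" "g ()"] by simp
qed (auto intro: tempered_const tempered_add tempered_mult)

text \<open>Chain rule by induction on the order: the partial of the composition in direction
  \<open>c\<close> is the sum over \<open>b\<close> of \<open>D i (\<phi> x) b * E b x c\<close>,
  where the first factor falls under the induction hypothesis and the second is tempered. The
  comparison of weights enters only through \<open>pull\<close>.\<close>

lemma est_compose:
  fixes \<phi> :: "'a::euclidean_space \<Rightarrow> 'b::euclidean_space"
  assumes "estimate U I Q" and pull: "\<And>f. R f \<Longrightarrow> Q (\<lambda>i x. f i (\<phi> x))"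
    and "\<And>x. x \<in> U \<Longrightarrow> \<phi> x \<in> V"
    and "\<And>b. b \<in> Basis \<Longrightarrow> tempered_order U m (\<lambda>x. \<phi> x \<bullet> b)"
    and "diff_estimate R I V m f"
  shows "diff_estimate Q I U m (\<lambda>i x. f i (\<phi> x))"
  using assms(4,5)
proof (induction m arbitrary: f)
  case (Suc m)
  interpret estimate U I Q by fact
  obtain D where D: "R f" "\<And>i y. i \<in> I \<Longrightarrow> y \<in> V \<Longrightarrow> (f i has_derivative D i y) (at y)"
    "\<And>b. b \<in> Basis \<Longrightarrow> diff_estimate R I V m (\<lambda>i y. D i y b)"
    using Suc.prems(2) by (rule diff_estimate_SucE) blast
  have "\<exists>E. (\<forall>x\<in>U. ((\<lambda>x. \<phi> x \<bullet> b) has_derivative E x) (at x)) \<and>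
      (\<forall>c\<in>Basis. tempered_order U m (\<lambda>x. E x c))" if "b \<in> Basis" for b
    using Suc.prems(1)[OF that] by (rule tempered_order_SucE) blast
  then obtain E where E: "\<And>b x. b \<in> Basis \<Longrightarrow> x \<in> U \<Longrightarrow> ((\<lambda>x. \<phi> x \<bullet> b) has_derivative E b x) (at x)"
    "\<And>b c. b \<in> Basis \<Longrightarrow> c \<in> Basis \<Longrightarrow> tempered_order U m (\<lambda>x. E b x c)"
    by metis
  have d\<phi>: "(\<phi> has_derivative (\<lambda>h. \<Sum>b\<in>Basis. E b x h *\<^sub>R b)) (at x)" if "x \<in> U" for x
    using E(1)[OF _ that] by (subst has_derivative_componentwise_within)
      (simp add: inner_sum_left inner_Basis if_distrib cong: if_cong)
  show ?case
  proof (rule diff_estimate_SucI[where D="\<lambda>i x h. \<Sum>b\<in>Basis. D i (\<phi> x) b * E b x h"])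
    show "Q (\<lambda>i x. f i (\<phi> x))" by (rule pull) fact
    show "((\<lambda>x. f i (\<phi> x)) has_derivative (\<lambda>h. \<Sum>b\<in>Basis. D i (\<phi> x) b * E b x h)) (at x)"
      if "i \<in> I" "x \<in> U" for i x
    proof -
      have Df: "(f i has_derivative D i (\<phi> x)) (at (\<phi> x))" using D(2) that assms(3) by blast
      interpret Df: bounded_linear "D i (\<phi> x)" using Df by (rule has_derivative_bounded_linear)
      have "(f i \<circ> \<phi> has_derivative D i (\<phi> x) \<circ> (\<lambda>h. \<Sum>b\<in>Basis. E b x h *\<^sub>R b)) (at x)"
        using d\<phi>[OF that(2)] Df by (rule diff_chain_at)
      then show ?thesis by (simp add: o_def Df.sum Df.scaleR mult.commute)
    qed
    show "est m (\<lambda>i x. \<Sum>b\<in>Basis. D i (\<phi> x) b * E b x c)" if "c \<in> Basis" for c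
    proof (rule est_sum)
      fix b :: 'b assume b: "b \<in> Basis"
      have "est m (\<lambda>i x. D i (\<phi> x) b)"
        using Suc.IH[OF diff_estimate_SucD[OF Suc.prems(1)] D(3)[OF b]] .
      then show "est m (\<lambda>i x. D i (\<phi> x) b * E b x c)" using E(2)[OF b that] by (rule est_mult)
    qed
  qed
qed (use pull in simp)

section \<open>The topology of Schwartz functions\<close>

text \<open>Smoothness guards every differentiation, as \<open>frechet_derivative\<close> is
  unspecified where differentiability fails.\<close>

lemma iter_partial_lincomb:
  fixes f g :: "'a::euclidean_space \<Rightarrow> real"
  assumes "smooth_on UNIV f" "smooth_on UNIV g" "set bs \<subseteq> Basis"
  shows "iter_partial bs (\<lambda>x. a * f x + c * g x) =
    (\<lambda>x. a * iter_partial bs f x + c * iter_partial bs g x)"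
  using assms(3)
proof (induction bs)
  case (Cons b bs)
  have bs: "set bs \<subseteq> Basis" using Cons.prems by simp
  have "((\<lambda>x. a * iter_partial bs f x + c * iter_partial bs g x) has_derivative
      (\<lambda>h. a * frechet_derivative (iter_partial bs f) (at x) h +
           c * frechet_derivative (iter_partial bs g) (at x) h)) (at x)" for x
    using assms(1,2) bs unfolding smooth_on_def
    by (intro has_derivative_add has_derivative_mult_right) (simp_all add: frechet_derivative_works[symmetric])
  from frechet_derivative_at[OF this, symmetric] show ?case
    by (simp add: Cons.IH[OF bs])
qed simp

lemma schwartz_functionsD:
  assumes "f \<in> schwartz_functions"
  shows "smooth_on UNIV f"
    and "set bs \<subseteq> Basis \<Longrightarrow> bdd_above (range (\<lambda>x. norm x ^ k * \<bar>iter_partial bs f x\<bar>))"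
proof -
  show "smooth_on UNIV f" using assms by (simp add: schwartz_functions_def)
  assume "set bs \<subseteq> Basis"
  then have "bounded (range (\<lambda>x. norm x ^ k * iter_partial bs f x))"
    using assms by (simp add: schwartz_functions_def)
  then show "bdd_above (range (\<lambda>x. norm x ^ k * \<bar>iter_partial bs f x\<bar>))"
    unfolding bounded_iff bdd_above_def by (simp add: abs_mult)
qed

lemma schwartz_seminorm_upper:
  assumes "f \<in> schwartz_functions" "set bs \<subseteq> Basis"
  shows "norm x ^ k * \<bar>iter_partial bs f x\<bar> \<le> schwartz_seminorm k bs f"
  unfolding schwartz_seminorm_def using schwartz_functionsD(2)[OF assms] by (intro cSUP_upper) auto

lemma schwartz_seminorm_least:
  "(\<And>x. norm x ^ k * \<bar>iter_partial bs f x\<bar> \<le> C) \<Longrightarrow> schwartz_seminorm k bs f \<le> C"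
  unfolding schwartz_seminorm_def by (intro cSUP_least) auto

lemma schwartz_seminorm_nonneg:
  assumes "f \<in> schwartz_functions" "set bs \<subseteq> Basis"
  shows "0 \<le> schwartz_seminorm k bs f"
proof -
  have "0 \<le> norm (0::'a) ^ k * \<bar>iter_partial bs f 0\<bar>" by simp
  also have "\<dots> \<le> schwartz_seminorm k bs f" using assms by (rule schwartz_seminorm_upper)
  finally show ?thesis .
qed

lemma schwartz_seminorm_lincomb:
  assumes "f \<in> schwartz_functions" "g \<in> schwartz_functions" "set bs \<subseteq> Basis"
  shows "norm x ^ k * \<bar>iter_partial bs (\<lambda>x. a * f x + c * g x) x\<bar> \<le>
      \<bar>a\<bar> * schwartz_seminorm k bs f + \<bar>c\<bar> * schwartz_seminorm k bs g"
proof -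
  have "norm x ^ k * \<bar>iter_partial bs (\<lambda>x. a * f x + c * g x) x\<bar> =
      norm x ^ k * \<bar>a * iter_partial bs f x + c * iter_partial bs g x\<bar>"
    using assms by (simp add: iter_partial_lincomb schwartz_functionsD)
  also have "\<dots> \<le> norm x ^ k * (\<bar>a\<bar> * \<bar>iter_partial bs f x\<bar> + \<bar>c\<bar> * \<bar>iter_partial bs g x\<bar>)"
    by (intro mult_left_mono) (auto simp: abs_mult[symmetric] abs_triangle_ineq)
  also have "\<dots> = \<bar>a\<bar> * (norm x ^ k * \<bar>iter_partial bs f x\<bar>) + \<bar>c\<bar> * (norm x ^ k * \<bar>iter_partial bs g x\<bar>)"
    by (simp add: algebra_simps)
  also have "\<dots> \<le> \<bar>a\<bar> * schwartz_seminorm k bs f + \<bar>c\<bar> * schwartz_seminorm k bs g"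
    using assms by (intro add_mono mult_left_mono schwartz_seminorm_upper) auto
  finally show ?thesis .
qed

lemma schwartz_functions_lincomb:
  assumes "f \<in> schwartz_functions" "g \<in> schwartz_functions"
  shows "(\<lambda>x. a * f x + c * g x) \<in> schwartz_functions"
  unfolding schwartz_functions_def mem_Collect_eq
proof (intro conjI allI impI)
  show "smooth_on UNIV (\<lambda>x. a * f x + c * g x)"
    unfolding smooth_on_def
  proof (intro allI impI ballI)
    fix bs x assume bs: "set bs \<subseteq> (Basis :: 'a set)"
    have "(\<lambda>x. a * iter_partial bs f x + c * iter_partial bs g x) differentiable at x"
      using assms[THEN schwartz_functionsD(1)] bs unfolding smooth_on_def
      by (intro derivative_intros) auto
    then show "iter_partial bs (\<lambda>x. a * f x + c * g x) differentiable at x"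
      using assms bs by (simp add: iter_partial_lincomb schwartz_functionsD)
  qed
next
  fix k bs assume "set bs \<subseteq> (Basis :: 'a set)"
  then show "bounded (range (\<lambda>x. norm x ^ k * iter_partial bs (\<lambda>x. a * f x + c * g x) x))"
    using schwartz_seminorm_lincomb[OF assms, of bs _ k a c] unfolding bounded_iff
    by (force simp: abs_mult)
qed

lemma schwartz_functions_on_lincomb:
  assumes "f \<in> schwartz_functions_on U" "g \<in> schwartz_functions_on U"
  shows "(\<lambda>x. a * f x + c * g x) \<in> schwartz_functions_on U"
  using assms schwartz_functions_lincomb[of f g a c] unfolding schwartz_functions_on_def
  by (simp add: iter_partial_lincomb schwartz_functionsD)

lemma schwartz_functions_diff:
  assumes "f \<in> schwartz_functions" "g \<in> schwartz_functions"
  shows "(\<lambda>x. f x - g x) \<in> schwartz_functions"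
  using schwartz_functions_lincomb[OF assms, of 1 "-1"] by simp

lemma schwartz_functions_on_diff:
  assumes "f \<in> schwartz_functions_on U" "g \<in> schwartz_functions_on U"
  shows "(\<lambda>x. f x - g x) \<in> schwartz_functions_on U"
  using schwartz_functions_on_lincomb[OF assms, of 1 "-1"] by simp

lemma schwartz_functions_on_subset: "schwartz_functions_on U \<subseteq> schwartz_functions"
  by (auto simp: schwartz_functions_on_def)

lemma schwartz_seminorm_triangle:
  assumes "f \<in> schwartz_functions" "g \<in> schwartz_functions" "h \<in> schwartz_functions" "set bs \<subseteq> Basis"
  shows "schwartz_seminorm k bs (\<lambda>x. f x - h x) \<le>
    schwartz_seminorm k bs (\<lambda>x. f x - g x) + schwartz_seminorm k bs (\<lambda>x. g x - h x)"
  using schwartz_seminorm_lincomb[OF schwartz_functions_diff[OF assms(1,2)]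
      schwartz_functions_diff[OF assms(2,3)] assms(4), of _ k 1 1]
  by (intro schwartz_seminorm_least) simp

lemma schwartz_seminorm_diff_self:
  assumes "f \<in> schwartz_functions" "set bs \<subseteq> Basis"
  shows "schwartz_seminorm k bs (\<lambda>x. f x - f x) = 0"
proof (rule antisym)
  have "iter_partial bs (\<lambda>x. 0 :: real) x = 0" for x
    using iter_partial_lincomb[of f f bs 0 0] assms schwartz_functionsD(1)[of f] by simp
  then show "schwartz_seminorm k bs (\<lambda>x. f x - f x) \<le> 0"
    by (intro schwartz_seminorm_least) simp
qed (use schwartz_functions_diff[of f f] schwartz_seminorm_nonneg assms in blast)

text \<open>An increasing sequence of seminorms that eventually dominates each single one, so that a
  continuity estimate needs just one index.\<close>

definition schwartz_size :: "nat \<Rightarrow> ('a::euclidean_space \<Rightarrow> real) \<Rightarrow> real" where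
  "schwartz_size n f =
    (\<Sum>(k, bs)\<in>{..n} \<times> {bs. set bs \<subseteq> Basis \<and> length bs \<le> n}. schwartz_seminorm k bs f)"

lemma finite_schwartz_index:
  "finite ({..n} \<times> {bs. set bs \<subseteq> (Basis :: 'a::euclidean_space set) \<and> length bs \<le> n})"
  using finite_lists_length_le[OF finite_Basis] by auto

lemma schwartz_seminorm_le_size:
  assumes "f \<in> schwartz_functions" "set bs \<subseteq> Basis" "k \<le> n" "length bs \<le> n"
  shows "schwartz_seminorm k bs f \<le> schwartz_size n f"
  unfolding schwartz_size_def
  using assms member_le_sum[of "(k,bs)" "{..n} \<times> {bs. set bs \<subseteq> Basis \<and> length bs \<le> n}"
      "\<lambda>(k,bs). schwartz_seminorm k bs f"] finite_schwartz_index
  by (auto intro: schwartz_seminorm_nonneg)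

lemma schwartz_size_nonneg: "f \<in> schwartz_functions \<Longrightarrow> 0 \<le> schwartz_size n f"
  unfolding schwartz_size_def by (auto intro!: sum_nonneg schwartz_seminorm_nonneg)

lemma schwartz_size_mono: "f \<in> schwartz_functions \<Longrightarrow> m \<le> n \<Longrightarrow> schwartz_size m f \<le> schwartz_size n f"
  unfolding schwartz_size_def
  by (rule sum_mono2[OF finite_schwartz_index]) (auto intro!: schwartz_seminorm_nonneg)

text \<open>The carrier of a generated topology is the union of its subbasic sets, so each Schwartz
  function has to be placed in one: a ball around itself.\<close>

lemma topspace_schwartz_topology_on: "topspace (schwartz_topology_on U) = schwartz_functions_on U"
proof -
  have "f \<in> topspace schwartz_topology" if "f \<in> schwartz_functions" for f :: "'a \<Rightarrow> real"
    unfolding schwartz_topology_def topology_generated_by_topspace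
    using that schwartz_seminorm_diff_self[OF that, of "[]" 0]
    by (intro UnionI[of "{g \<in> schwartz_functions. schwartz_seminorm 0 [] (\<lambda>x. g x - f x) < 1}"]
        CollectI exI[of _ f] exI[of _ "0::nat"] exI[of _ "[]"] exI[of _ "1::real"]) auto
  moreover have "schwartz_functions_on U \<subseteq> schwartz_functions" by (auto simp: schwartz_functions_on_def)
  ultimately show ?thesis by (auto simp: schwartz_topology_on_def)
qed

lemma openin_schwartz_size_ball:
  assumes "f \<in> schwartz_functions_on U" "0 < e"
  shows "\<exists>W. openin (schwartz_topology_on U) W \<and> f \<in> W \<and>
    (\<forall>g\<in>W. schwartz_size n (\<lambda>x. g x - f x) < e)"
proof -
  define J where "J = {..n} \<times> {bs. set bs \<subseteq> (Basis :: 'a set) \<and> length bs \<le> n}"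
  have J: "finite J" "J \<noteq> {}" unfolding J_def
    using finite_schwartz_index by (auto intro: exI[of _ "[]"])
  have f: "f \<in> schwartz_functions" using assms schwartz_functions_on_subset by blast
  \<comment> \<open>Each of the \<open>card J\<close> summands of \<open>schwartz_size\<close> is
    kept below an equal share of \<open>e\<close>.\<close>
  define d where "d = e / real (card J)"
  have d: "0 < d" using assms J unfolding d_def by (simp add: card_gt_0_iff)
  define B where "B = (\<lambda>(k,bs). {g \<in> schwartz_functions. schwartz_seminorm k bs (\<lambda>x. g x - f x) < d})"
  have "openin schwartz_topology (B j)" if "j \<in> J" for j
    unfolding schwartz_topology_def
    by (rule topology_generated_by_Basis) (use f d that in \<open>auto simp: B_def J_def\<close>)
  then have "openin schwartz_topology (\<Inter>j\<in>J. B j)" using J by (intro openin_INT2) auto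
  moreover have "f \<in> B j" if "j \<in> J" for j
    using schwartz_seminorm_diff_self[OF f] f d that by (auto simp: B_def J_def)
  moreover have "schwartz_size n (\<lambda>x. g x - f x) < e" if "g \<in> (\<Inter>j\<in>J. B j)" for g
  proof -
    have "schwartz_size n (\<lambda>x. g x - f x) < (\<Sum>j\<in>J. d)"
      unfolding schwartz_size_def J_def[symmetric] using J that by (intro sum_strict_mono) (auto simp: B_def)
    then show ?thesis using J by (simp add: d_def)
  qed
  ultimately show ?thesis using assms(1) unfolding schwartz_topology_on_def
    by (intro exI[of _ "(\<Inter>j\<in>J. B j) \<inter> schwartz_functions_on U"]) (auto simp: openin_subtopology)
qed

text \<open>Preimages of subbasic balls suffice. The bound is applied to the difference of two
  functions, and \<open>diff\<close> turns it into a Lipschitz estimate for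
  \<open>T\<close>.\<close>

lemma continuous_map_schwartz:
  fixes T :: "('a::euclidean_space \<Rightarrow> real) \<Rightarrow> 'b::euclidean_space \<Rightarrow> real"
  assumes maps: "\<And>s. s \<in> schwartz_functions_on V \<Longrightarrow> T s \<in> schwartz_functions_on U"
    and diff: "\<And>s t. s \<in> schwartz_functions_on V \<Longrightarrow> t \<in> schwartz_functions_on V \<Longrightarrow>
        T (\<lambda>x. s x - t x) = (\<lambda>x. T s x - T t x)"
    and bound: "\<And>k bs. set bs \<subseteq> Basis \<Longrightarrow> \<exists>n C. \<forall>s\<in>schwartz_functions_on V.
        schwartz_seminorm k bs (T s) \<le> C * schwartz_size n s"
  shows "continuous_map (schwartz_topology_on V) (schwartz_topology_on U) T"
proof -
  have "continuous_map (schwartz_topology_on V) schwartz_topology T"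
    unfolding schwartz_topology_def
  proof (rule continuous_on_generated_topo)
    show "T ` topspace (schwartz_topology_on V) \<subseteq> \<Union> {{g \<in> schwartz_functions. schwartz_seminorm k bs (\<lambda>x. g x - f x) < e} | f k bs e.
        f \<in> schwartz_functions \<and> set bs \<subseteq> Basis \<and> e > 0}"
    proof (rule image_subsetI)
      fix s assume "s \<in> topspace (schwartz_topology_on V)"
      then have "T s \<in> topspace (schwartz_topology_on U)"
        using maps by (simp add: topspace_schwartz_topology_on)
      then show "T s \<in> \<Union> {{g \<in> schwartz_functions. schwartz_seminorm k bs (\<lambda>x. g x - f x) < e} | f k bs e.
        f \<in> schwartz_functions \<and> set bs \<subseteq> Basis \<and> e > 0}"
        by (simp add: schwartz_topology_on_def schwartz_topology_def)
    qed
  next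
    fix B :: "('b \<Rightarrow> real) set"
    assume "B \<in> {{g \<in> schwartz_functions. schwartz_seminorm k bs (\<lambda>x. g x - f x) < e} | f k bs e.
        f \<in> schwartz_functions \<and> set bs \<subseteq> Basis \<and> e > 0}"
    then obtain f k bs e where f: "f \<in> schwartz_functions" "set bs \<subseteq> Basis" "e > 0" and
      B: "B = {g \<in> schwartz_functions. schwartz_seminorm k bs (\<lambda>x. g x - f x) < e}" by blast
    obtain n C where C: "\<And>s. s \<in> schwartz_functions_on V \<Longrightarrow>
        schwartz_seminorm k bs (T s) \<le> C * schwartz_size n s" using bound[OF f(2)] by blast
    show "openin (schwartz_topology_on V) (T -` B \<inter> topspace (schwartz_topology_on V))"
    proof (subst openin_subopen, intro ballI)
      fix s assume "s \<in> T -` B \<inter> topspace (schwartz_topology_on V)"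
      then have s: "s \<in> schwartz_functions_on V" "T s \<in> schwartz_functions"
        "schwartz_seminorm k bs (\<lambda>x. T s x - f x) < e"
        by (auto simp: topspace_schwartz_topology_on B)
      \<comment> \<open>The room left inside the ball, divided by a Lipschitz constant;
        \<open>\<bar>C\<bar> + 1\<close> stands in for \<open>C\<close>, which may be zero or
        negative.\<close>
      define d where "d = (e - schwartz_seminorm k bs (\<lambda>x. T s x - f x)) / (\<bar>C\<bar> + 1)"
      have d: "0 < d" using s by (simp add: d_def)
      obtain W where W: "openin (schwartz_topology_on V) W" "s \<in> W"
        "\<And>t. t \<in> W \<Longrightarrow> schwartz_size n (\<lambda>x. t x - s x) < d"
        using openin_schwartz_size_ball[OF s(1) d, of n] by metis
      have "W \<subseteq> T -` B \<inter> topspace (schwartz_topology_on V)"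
      proof
        fix t assume t: "t \<in> W"
        then have tV: "t \<in> schwartz_functions_on V"
          using openin_subset[OF W(1)] topspace_schwartz_topology_on by blast
        have Tt: "T t \<in> schwartz_functions" using maps[OF tV] schwartz_functions_on_subset by blast
        have ts: "(\<lambda>x. t x - s x) \<in> schwartz_functions_on V"
          using tV s(1) by (rule schwartz_functions_on_diff)
        then have nn: "0 \<le> schwartz_size n (\<lambda>x. t x - s x)"
          using schwartz_functions_on_subset by (intro schwartz_size_nonneg) blast
        have "schwartz_seminorm k bs (\<lambda>x. T t x - T s x) \<le> C * schwartz_size n (\<lambda>x. t x - s x)"
          using C[OF ts] diff[OF tV s(1)] by simp
        also have "\<dots> \<le> (\<bar>C\<bar> + 1) * schwartz_size n (\<lambda>x. t x - s x)"
          using nn by (intro mult_right_mono) auto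
        also have "\<dots> < (\<bar>C\<bar> + 1) * d" using W(3)[OF t] by (intro mult_strict_left_mono) auto
        finally have "schwartz_seminorm k bs (\<lambda>x. T t x - T s x) < e - schwartz_seminorm k bs (\<lambda>x. T s x - f x)"
          by (simp add: d_def)
        then have "schwartz_seminorm k bs (\<lambda>x. T t x - f x) < e"
          using schwartz_seminorm_triangle[OF Tt s(2) f(1,2), of k] by linarith
        then show "t \<in> T -` B \<inter> topspace (schwartz_topology_on V)"
          using tV Tt by (auto simp: B topspace_schwartz_topology_on)
      qed
      then show "\<exists>W. openin (schwartz_topology_on V) W \<and> s \<in> W \<and>
          W \<subseteq> T -` B \<inter> topspace (schwartz_topology_on V)" using W by blast
    qed
  qed
  then show ?thesis unfolding schwartz_topology_on_def[of U] continuous_map_in_subtopology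
    using maps by (auto simp: topspace_schwartz_topology_on)
qed

section \<open>Decay of Schwartz functions at the boundary\<close>

text \<open>Reduces powers of \<open>1 + norm y\<close> to the powers \<open>0\<close> and
  \<open>k\<close> of the norm, which the seminorms measure.\<close>

lemma one_plus_power_le: "0 \<le> (a::real) \<Longrightarrow> (1 + a) ^ k \<le> 2 ^ k * (1 + a ^ k)"
proof (cases "a \<le> 1")
  case True
  assume "0 \<le> a"
  then have "(1 + a) ^ k \<le> 2 ^ k" using True by (intro power_mono) auto
  also have "\<dots> \<le> 2 ^ k * (1 + a ^ k)" using \<open>0 \<le> a\<close> by (simp add: distrib_left)
  finally show ?thesis .
next
  case False
  then have "(1 + a) ^ k \<le> (2 * a) ^ k" by (intro power_mono) auto
  also have "\<dots> \<le> 2 ^ k * (1 + a ^ k)" by (simp add: power_mult_distrib)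
  finally show ?thesis .
qed

text \<open>All derivatives vanish at the boundary point nearest to \<open>y\<close>, so integrating along
  the segment to it gains one power of the distance per derivative.\<close>

lemma schwartz_boundary_decay:
  fixes s :: "'a::euclidean_space \<Rightarrow> real"
  assumes V: "open V" "V \<noteq> UNIV" and s: "s \<in> schwartz_functions_on V" and "k \<le> n"
    and "set bs \<subseteq> Basis" "length bs + j \<le> n" "y \<in> V"
  shows "(1 + norm y) ^ k * \<bar>iter_partial bs s y\<bar> \<le>
    2 ^ k * 2 * (2 ^ k * real DIM('a)) ^ j * schwartz_size n s * min 1 (infdist y (- V)) ^ j"
  using assms(5,6,7)
proof (induction j arbitrary: bs y)
  case 0
  have sS: "s \<in> schwartz_functions" using s schwartz_functions_on_subset by blast
  have "(1 + norm y) ^ k * \<bar>iter_partial bs s y\<bar> \<le> 2 ^ k * (1 + norm y ^ k) * \<bar>iter_partial bs s y\<bar>"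
    by (intro mult_right_mono one_plus_power_le) auto
  also have "\<dots> = 2 ^ k * (norm y ^ 0 * \<bar>iter_partial bs s y\<bar> + norm y ^ k * \<bar>iter_partial bs s y\<bar>)"
    by (simp add: algebra_simps)
  also have "\<dots> \<le> 2 ^ k * (schwartz_size n s + schwartz_size n s)"
    using sS 0 \<open>k \<le> n\<close> 
    by (intro mult_left_mono add_mono order_trans[OF schwartz_seminorm_upper schwartz_seminorm_le_size]) auto
  finally show ?case by simp
next
  case (Suc j)
  let ?d = "infdist y (- V)"
  define M where "M = 2 ^ k * 2 * (2 ^ k * real DIM('a)) ^ j * schwartz_size n s"
  have sS: "s \<in> schwartz_functions" using s schwartz_functions_on_subset by blast
  have M: "0 \<le> M" using schwartz_size_nonneg[OF sS] by (simp add: M_def)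
  define P where "P = (1 + norm y) ^ k"
  have P: "0 < P" unfolding P_def by (intro zero_less_power) (use norm_ge_zero[of y] in linarith)
  have IH: "(1 + norm y) ^ k * \<bar>iter_partial bs s y\<bar> \<le> M * min 1 (infdist y (- V)) ^ j"
    if "set bs \<subseteq> Basis" "length bs + j \<le> n" "y \<in> V" for bs y
    using Suc.IH[OF that] by (simp only: M_def)
  \<comment> \<open>Each unit of \<open>j\<close> costs a factor \<open>2 ^ k\<close> for moving the
    norm weight along a segment and a factor \<open>real DIM('a)\<close> for passing from partials
    to the full derivative.\<close>
  have goal_eq: "2 ^ k * 2 * (2 ^ k * real DIM('a)) ^ Suc j * schwartz_size n s = real DIM('a) * (2 ^ k * M)"
    by (simp add: M_def mult_ac)
  show ?case
  proof (cases "1 \<le> ?d")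
    case True
    \<comment> \<open>At distance at least one the minimum is \<open>1\<close>, and the induction
      hypothesis for the same \<open>bs\<close> already suffices.\<close>
    have "(1 + norm y) ^ k * \<bar>iter_partial bs s y\<bar> \<le> M * 1"
      using IH[of bs y] Suc.prems True by simp
    also have "\<dots> \<le> M * (2 ^ k * real DIM('a))"
      using mult_mono[OF one_le_power[of "2::real" k], of 1 "real DIM('a)"]
      by (intro mult_left_mono M) (auto simp: Suc_leI)
    finally show ?thesis using True unfolding goal_eq by (simp add: mult_ac)
  next
    case False
    obtain z where z: "z \<in> - V" "?d = dist y z"
      using infdist_attains_inf[of "- V" y] V by auto
    let ?g = "iter_partial bs s"
    have sz: "\<And>bs x. set bs \<subseteq> Basis \<Longrightarrow> x \<notin> V \<Longrightarrow> iter_partial bs s x = 0"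
      using s by (auto simp: schwartz_functions_on_def)
    have deriv: "(?g has_derivative frechet_derivative ?g (at x)) (at x within closed_segment z y)" for x
    proof -
      have "?g differentiable (at x)"
        using schwartz_functionsD(1)[OF sS] Suc.prems(1) unfolding smooth_on_def by blast
      then show ?thesis unfolding frechet_derivative_works by (rule has_derivative_at_withinI)
    qed
    define B where "B = real DIM('a) * (2 ^ k * M * ?d ^ j / P)"
    have partial: "\<bar>iter_partial (b # bs) s x\<bar> \<le> 2 ^ k * M * ?d ^ j / P"
      if x: "x \<in> closed_segment z y" and b: "b \<in> Basis" for x b
    proof (cases "x \<in> V")
      case True
      have xz: "dist x z \<le> ?d" "dist y x \<le> ?d"
        using x dist_in_closed_segment[of x z y] z by (auto simp: dist_commute)
      \<comment> \<open>No point of the segment is farther than \<open>?d\<close> from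
        \<open>z\<close>, so the induction hypothesis gives a uniform bound along it.\<close>
      have "infdist x (- V) \<le> ?d" using z xz infdist_le2 by blast
      then have dd: "min 1 (infdist x (- V)) ^ j \<le> ?d ^ j" by (intro power_mono) (auto simp: infdist_nonneg)
      \<comment> \<open>The segment is shorter than \<open>1\<close>, which is why the distant case
        was split off: the weight at \<open>y\<close> is at most twice the weight at
        \<open>x\<close>.\<close>
      have "norm y \<le> norm x + dist y x" using norm_triangle_sub[of y x] by (simp add: dist_norm)
      then have ny: "1 + norm y \<le> 2 * (1 + norm x)" using xz False by (smt (verit) norm_ge_zero)
      have "(1 + norm y) ^ k * \<bar>iter_partial (b # bs) s x\<bar> \<le> (2 * (1 + norm x)) ^ k * \<bar>iter_partial (b # bs) s x\<bar>"
        using ny by (intro mult_right_mono power_mono) auto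
      also have "\<dots> = 2 ^ k * ((1 + norm x) ^ k * \<bar>iter_partial (b # bs) s x\<bar>)"
        by (simp only: power_mult_distrib mult.assoc)
      also have "\<dots> \<le> 2 ^ k * (M * min 1 (infdist x (- V)) ^ j)"
        using IH[of "b # bs" x] Suc.prems True b by (intro mult_left_mono) auto
      also have "\<dots> \<le> 2 ^ k * (M * ?d ^ j)" using M dd by (intro mult_left_mono) auto
      finally have "(1 + norm y) ^ k * \<bar>iter_partial (b # bs) s x\<bar> \<le> 2 ^ k * M * ?d ^ j"
        by (simp only: mult.assoc)
      then show ?thesis using P by (simp only: P_def[symmetric] pos_le_divide_eq mult.commute[of P])
    next
      \<comment> \<open>Off \<open>V\<close>, in particular at \<open>z\<close>, all derivatives
        vanish.\<close>
      case False
      have "0 \<le> 2 ^ k * M * ?d ^ j / P"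
        using M P by (intro divide_nonneg_nonneg mult_nonneg_nonneg zero_le_power) (auto simp: infdist_nonneg)
      then show ?thesis using sz[OF _ False, of "b # bs"] b Suc.prems by simp
    qed
    have "onorm (frechet_derivative ?g (at x)) \<le> B" if x: "x \<in> closed_segment z y" for x
    proof -
      have bl: "bounded_linear (frechet_derivative ?g (at x))"
        using deriv[of x] by (rule has_derivative_bounded_linear)
      have "onorm (frechet_derivative ?g (at x)) \<le> (\<Sum>b\<in>Basis. \<bar>frechet_derivative ?g (at x) b\<bar>)"
        using onorm_componentwise[OF bl] by simp
      also have "\<dots> \<le> (\<Sum>b\<in>(Basis :: 'a set). 2 ^ k * M * ?d ^ j / P)"
        using partial[OF x] by (intro sum_mono) simp
      also have "\<dots> = B" by (simp add: B_def)
      finally show ?thesis .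
    qed
    then have "norm (?g y - ?g z) \<le> B * norm (y - z)"
      by (intro differentiable_bound[OF convex_closed_segment deriv]) auto
    then have "\<bar>?g y\<bar> \<le> B * ?d" using sz[of bs z] Suc.prems z by (simp add: dist_norm)
    also have "\<dots> = (real DIM('a) * (2 ^ k * M) * ?d ^ Suc j) / P"
      by (simp add: B_def mult_ac)
    finally have "P * \<bar>?g y\<bar> \<le> real DIM('a) * (2 ^ k * M) * ?d ^ Suc j"
      using P by (simp only: pos_le_divide_eq mult.commute[of P])
    then show ?thesis using False unfolding goal_eq P_def[symmetric] by (simp add: min_def)
  qed
qed

section \<open>Pullback along tempered maps\<close>

text \<open>\<open>n\<close> and \<open>C\<close> are chosen before \<open>s\<close>: one statement
  holds both the decay of each function and its continuous dependence on \<open>s\<close> in the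
  Schwartz seminorms.\<close>

definition rapid ::
  "('a::euclidean_space \<Rightarrow> real) set \<Rightarrow> 'b::euclidean_space set \<Rightarrow>
   (('a \<Rightarrow> real) \<Rightarrow> 'b \<Rightarrow> real) \<Rightarrow> bool" where
  "rapid F U T \<longleftrightarrow> (\<forall>N. \<exists>n C. \<forall>s\<in>F. \<forall>x\<in>U.
     boundary_weight U x ^ N * \<bar>T s x\<bar> \<le> C * schwartz_size n s)"

text \<open>The index may be raised at will, so that two estimates can be brought to a common one
  before they are added.\<close>

lemma rapidD:
  assumes "rapid F U T"
  obtains n C where "0 \<le> C"
    "\<And>m s x. n \<le> m \<Longrightarrow> F \<subseteq> schwartz_functions \<Longrightarrow> s \<in> F \<Longrightarrow> x \<in> U \<Longrightarrow>
       boundary_weight U x ^ N * \<bar>T s x\<bar> \<le> C * schwartz_size m s"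
proof -
  obtain n C where C: "\<And>s x. s \<in> F \<Longrightarrow> x \<in> U \<Longrightarrow>
      boundary_weight U x ^ N * \<bar>T s x\<bar> \<le> C * schwartz_size n s"
    using assms unfolding rapid_def by metis
  have "boundary_weight U x ^ N * \<bar>T s x\<bar> \<le> \<bar>C\<bar> * schwartz_size m s"
    if "n \<le> m" "F \<subseteq> schwartz_functions" "s \<in> F" "x \<in> U" for m s x
  proof -
    have s: "s \<in> schwartz_functions" using that by auto
    have "C * schwartz_size n s \<le> \<bar>C\<bar> * schwartz_size m s"
      using schwartz_size_nonneg[OF s] schwartz_size_mono[OF s that(1)] by (intro mult_mono) auto
    then show ?thesis using C[OF that(3,4)] by linarith
  qed
  then show thesis using that[of "\<bar>C\<bar>" n] by auto
qed

lemma estimate_rapid: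
  assumes "F \<subseteq> schwartz_functions"
  shows "estimate U F (rapid F U)"
proof
  show "rapid F U (\<lambda>i x. 0)"
    unfolding rapid_def by (intro allI exI[of _ "0::nat"] exI[of _ "0::real"]) simp
next
  fix f g assume f: "rapid F U f" and g: "rapid F U g"
  show "rapid F U (\<lambda>i x. f i x + g i x)"
    unfolding rapid_def
  proof
    fix N
    obtain n C where C: "\<And>m s x. n \<le> m \<Longrightarrow> s \<in> F \<Longrightarrow> x \<in> U \<Longrightarrow>
       boundary_weight U x ^ N * \<bar>f s x\<bar> \<le> C * schwartz_size m s"
      using rapidD[OF f] assms by metis
    obtain n' C' where C': "\<And>m s x. n' \<le> m \<Longrightarrow> s \<in> F \<Longrightarrow> x \<in> U \<Longrightarrow>
       boundary_weight U x ^ N * \<bar>g s x\<bar> \<le> C' * schwartz_size m s"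
      using rapidD[OF g] assms by metis
    have "boundary_weight U x ^ N * \<bar>f s x + g s x\<bar> \<le> (C + C') * schwartz_size (max n n') s"
      if "s \<in> F" "x \<in> U" for s x
    proof -
      have "boundary_weight U x ^ N * \<bar>f s x + g s x\<bar> \<le>
          boundary_weight U x ^ N * (\<bar>f s x\<bar> + \<bar>g s x\<bar>)"
        using boundary_weight_ge_1[of U x] by (intro mult_left_mono) auto
      also have "\<dots> \<le> (C + C') * schwartz_size (max n n') s"
        using C[of "max n n'" s x] C'[of "max n n'" s x] that by (simp add: algebra_simps)
      finally show ?thesis .
    qed
    then show "\<exists>n C. \<forall>s\<in>F. \<forall>x\<in>U. boundary_weight U x ^ N * \<bar>f s x + g s x\<bar> \<le> C * schwartz_size n s"
      by blast
  qed
next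
  fix f h assume f: "rapid F U f" and h: "tempered U h"
  obtain K k where K: "0 \<le> K" "\<And>x. x \<in> U \<Longrightarrow> \<bar>h x\<bar> \<le> K * boundary_weight U x ^ k"
    using h temperedE by blast
  show "rapid F U (\<lambda>i x. f i x * h x)"
    unfolding rapid_def
  proof
    fix N
    \<comment> \<open>The \<open>k\<close> powers of the weight that \<open>h\<close> may cost are
      taken from the decay of \<open>f\<close> at exponent \<open>N + k\<close>.\<close>
    obtain n C where C: "\<And>m s x. n \<le> m \<Longrightarrow> s \<in> F \<Longrightarrow> x \<in> U \<Longrightarrow>
       boundary_weight U x ^ (N + k) * \<bar>f s x\<bar> \<le> C * schwartz_size m s"
      using rapidD[OF f] assms by metis
    have "boundary_weight U x ^ N * \<bar>f s x * h x\<bar> \<le> (K * C) * schwartz_size n s"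
      if "s \<in> F" "x \<in> U" for s x
    proof -
      have "boundary_weight U x ^ N * \<bar>f s x * h x\<bar> \<le>
          boundary_weight U x ^ N * (\<bar>f s x\<bar> * (K * boundary_weight U x ^ k))"
        unfolding abs_mult using boundary_weight_ge_1[of U x] K(2)[OF that(2)]
        by (intro mult_left_mono) auto
      also have "\<dots> = K * (boundary_weight U x ^ (N + k) * \<bar>f s x\<bar>)"
        by (simp add: power_add mult_ac)
      also have "\<dots> \<le> K * (C * schwartz_size n s)" using C that K by (intro mult_left_mono) auto
      finally show ?thesis by (simp only: mult.assoc)
    qed
    then show "\<exists>n C. \<forall>s\<in>F. \<forall>x\<in>U. boundary_weight U x ^ N * \<bar>f s x * h x\<bar> \<le> C * schwartz_size n s"
      by blast
  qed
next
  fix f g :: "('a \<Rightarrow> real) \<Rightarrow> 'b \<Rightarrow> real"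
  assume "\<And>i x. i \<in> F \<Longrightarrow> x \<in> U \<Longrightarrow> f i x = g i x" "rapid F U f"
  then show "rapid F U g" unfolding rapid_def by simp
qed

text \<open>Decay is known in the weight of \<open>V\<close> and wanted in that of \<open>U\<close>.
  As \<open>x = \<psi> (\<phi> x)\<close>, the growth bound for \<open>\<psi>\<close> controls the
  weight of \<open>U\<close> at \<open>x\<close> by a power of the weight of \<open>V\<close> at
  \<open>\<phi> x\<close>: this is where temperedness of the inverse enters.\<close>

lemma rapid_compose:
  assumes "rapid F V T" "tempered V (\<lambda>y. boundary_weight U (\<psi> y))"
    and "\<And>x. x \<in> U \<Longrightarrow> \<phi> x \<in> V" "\<And>x. x \<in> U \<Longrightarrow> \<psi> (\<phi> x) = x"
  shows "rapid F U (\<lambda>s x. T s (\<phi> x))"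
  unfolding rapid_def
proof
  fix N
  obtain K k where K: "0 \<le> K" "\<And>y. y \<in> V \<Longrightarrow> \<bar>boundary_weight U (\<psi> y)\<bar> \<le> K * boundary_weight V y ^ k"
    using assms(2) temperedE by blast
  obtain n C where C: "\<And>s x. s \<in> F \<Longrightarrow> x \<in> V \<Longrightarrow>
     boundary_weight V x ^ (k * N) * \<bar>T s x\<bar> \<le> C * schwartz_size n s"
    using assms(1) unfolding rapid_def by metis
  have "boundary_weight U x ^ N * \<bar>T s (\<phi> x)\<bar> \<le> (K ^ N * C) * schwartz_size n s"
    if "s \<in> F" "x \<in> U" for s x
  proof -
    have "boundary_weight U x \<le> K * boundary_weight V (\<phi> x) ^ k"
      using K(2)[of "\<phi> x"] assms(3,4) that by auto
    then have "boundary_weight U x ^ N \<le> (K * boundary_weight V (\<phi> x) ^ k) ^ N"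
      using boundary_weight_ge_1[of U x] by (intro power_mono) auto
    then have "boundary_weight U x ^ N * \<bar>T s (\<phi> x)\<bar> \<le>
        (K * boundary_weight V (\<phi> x) ^ k) ^ N * \<bar>T s (\<phi> x)\<bar>"
      by (rule mult_right_mono) simp
    also have "\<dots> = K ^ N * (boundary_weight V (\<phi> x) ^ (k * N) * \<bar>T s (\<phi> x)\<bar>)"
      by (simp add: power_mult_distrib power_mult)
    also have "\<dots> \<le> K ^ N * (C * schwartz_size n s)"
      using C that assms(3) K(1) by (intro mult_left_mono) auto
    finally show ?thesis by (simp only: mult.assoc)
  qed
  then show "\<exists>n C. \<forall>s\<in>F. \<forall>x\<in>U. boundary_weight U x ^ N * \<bar>T s (\<phi> x)\<bar> \<le> C * schwartz_size n s"
    by blast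
qed

text \<open>Boundary decay with both exponents equal to \<open>N\<close>: the weight is at most
  twice the quotient of \<open>1 + norm y\<close> by the distance truncated at
  \<open>1\<close>.\<close>

lemma rapid_iter_partial:
  fixes V :: "'a::euclidean_space set"
  assumes V: "open V" "V \<noteq> UNIV" and bs: "set bs \<subseteq> Basis"
  shows "rapid (schwartz_functions_on V) V (iter_partial bs)"
  unfolding rapid_def
proof
  fix N
  \<comment> \<open>\<open>N\<close> further derivatives buy \<open>N\<close> powers of the
    distance; the same index covers the norm exponent \<open>N\<close>.\<close>
  let ?n = "length bs + N"
  let ?C = "2 ^ N * (2 ^ N * 2 * (2 ^ N * real DIM('a)) ^ N)"
  have "boundary_weight V y ^ N * \<bar>iter_partial bs s y\<bar> \<le> ?C * schwartz_size ?n s"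
    if s: "s \<in> schwartz_functions_on V" and y: "y \<in> V" for s y
  proof -
    let ?d = "min 1 (infdist y (- V))"
    have d: "0 < ?d" "?d \<le> 1" "?d \<noteq> 0" using infdist_compl_pos[OF V y] by auto
    have "inverse (infdist y (- V)) \<le> inverse ?d"
      using infdist_compl_pos[OF V y] by (intro le_imp_inverse_le) auto
    also have "\<dots> \<le> (1 + norm y) / ?d" using d by (simp add: inverse_eq_divide divide_right_mono)
    finally have "inverse (infdist y (- V)) \<le> (1 + norm y) / ?d" .
    moreover have "1 + norm y \<le> (1 + norm y) / ?d"
      using d norm_ge_zero[of y] by (simp only: pos_le_divide_eq) (simp add: mult_left_le)
    ultimately have "boundary_weight V y \<le> 2 * ((1 + norm y) / ?d)"
      unfolding boundary_weight_def by linarith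
    then have "boundary_weight V y ^ N \<le> (2 * ((1 + norm y) / ?d)) ^ N"
      using boundary_weight_ge_1[of V y] by (intro power_mono) auto
    also have "\<dots> = 2 ^ N * (1 + norm y) ^ N / ?d ^ N"
      by (simp only: power_mult_distrib power_divide times_divide_eq_right)
    finally have "boundary_weight V y ^ N * \<bar>iter_partial bs s y\<bar> \<le>
        2 ^ N * (1 + norm y) ^ N / ?d ^ N * \<bar>iter_partial bs s y\<bar>"
      by (rule mult_right_mono) simp
    also have "\<dots> = 2 ^ N * ((1 + norm y) ^ N * \<bar>iter_partial bs s y\<bar>) / ?d ^ N"
      by simp
    also have "\<dots> \<le> 2 ^ N * (2 ^ N * 2 * (2 ^ N * real DIM('a)) ^ N * schwartz_size ?n s * ?d ^ N) / ?d ^ N"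
      using schwartz_boundary_decay[OF V s _ bs _ y, of N ?n N] d
      by (intro divide_right_mono mult_left_mono) auto
    also have "\<dots> = ?C * schwartz_size ?n s"
      by (simp only: mult.assoc[symmetric] nonzero_mult_div_cancel_right[OF power_not_zero[OF d(3)]])
    finally show ?thesis .
  qed
  then show "\<exists>n C. \<forall>s\<in>schwartz_functions_on V. \<forall>x\<in>V.
      boundary_weight V x ^ N * \<bar>iter_partial bs s x\<bar> \<le> C * schwartz_size n s"
    by blast
qed

lemma est_rapid_schwartz:
  fixes V :: "'a::euclidean_space set"
  assumes V: "open V" "V \<noteq> UNIV"
  shows "diff_estimate (rapid (schwartz_functions_on V) V) (schwartz_functions_on V) V m (\<lambda>s. s)"
proof -
  interpret estimate V "schwartz_functions_on V" "rapid (schwartz_functions_on V) V"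
    by (rule estimate_rapid[OF schwartz_functions_on_subset])
  show ?thesis
  proof (rule est_if_iter_partial)
    show "iter_partial bs s differentiable (at x)"
      if "set bs \<subseteq> Basis" "s \<in> schwartz_functions_on V" for bs s x
    proof -
      have "smooth_on UNIV s"
        using that(2) schwartz_functions_on_subset by (intro schwartz_functionsD(1)) blast
      then show ?thesis using that(1) unfolding smooth_on_def by blast
    qed
  qed (use rapid_iter_partial[OF V] in auto)
qed

text \<open>At a point outside \<open>U\<close> the extended partial is dominated by the squared
  distance to that point, hence differentiable there with derivative zero. So extension by zero
  commutes with each further differentiation.\<close>

lemma zero_extension:
  fixes f :: "'a::euclidean_space \<Rightarrow> real"
  assumes U: "open U"
    and diff: "\<And>bs x. set bs \<subseteq> Basis \<Longrightarrow> x \<in> U \<Longrightarrow> iter_partial bs f differentiable (at x)"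
    and decay: "\<And>bs. set bs \<subseteq> Basis \<Longrightarrow>
      \<exists>C. \<forall>x\<in>U. boundary_weight U x ^ 2 * \<bar>iter_partial bs f x\<bar> \<le> C"
    and "set bs \<subseteq> Basis"
  defines "h \<equiv> \<lambda>bs x. if x \<in> U then iter_partial bs f x else 0"
  shows "iter_partial bs (h []) = h bs" and "h bs differentiable (at x)"
proof -
  have deriv: "(h bs has_derivative (if x \<in> U then frechet_derivative (iter_partial bs f) (at x) else (\<lambda>_. 0))) (at x)"
    if bs: "set bs \<subseteq> Basis" for bs x
  proof (cases "x \<in> U")
    case True
    have "(iter_partial bs f has_derivative frechet_derivative (iter_partial bs f) (at x)) (at x)"
      using diff[OF bs True] unfolding frechet_derivative_works .
    then have "(h bs has_derivative frechet_derivative (iter_partial bs f) (at x)) (at x)"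
      by (rule has_derivative_transform_within_open[OF _ U True]) (simp add: h_def)
    then show ?thesis using True by simp
  next
    case False
    obtain C where C: "\<And>x. x \<in> U \<Longrightarrow> boundary_weight U x ^ 2 * \<bar>iter_partial bs f x\<bar> \<le> C"
      using decay[OF bs] by blast
    \<comment> \<open>One of the two powers offsets the denominator of the difference quotient, the
      other makes it tend to zero.\<close>
    have "\<bar>h bs y\<bar> \<le> \<bar>C\<bar> * dist y x ^ 2" if "y \<noteq> x" for y
    proof (cases "y \<in> U")
      case True
      have "inverse (dist y x) \<le> boundary_weight U y"
        using inverse_le_boundary_weight[OF U True False] by simp
      then have "inverse (dist y x) ^ 2 \<le> boundary_weight U y ^ 2" by (intro power_mono) auto
      then have "inverse (dist y x) ^ 2 * \<bar>h bs y\<bar> \<le> boundary_weight U y ^ 2 * \<bar>h bs y\<bar>"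
        by (rule mult_right_mono) simp
      also have "\<dots> \<le> \<bar>C\<bar>" using C[OF True] True by (simp add: h_def)
      finally show ?thesis using that by (simp add: divide_simps mult.commute)
    qed (simp add: h_def)
    then have "norm (h bs y - h bs x - 0) / norm (y - x) \<le> \<bar>C\<bar> * dist y x" if "y \<noteq> x" for y
      using that False by (simp add: h_def dist_norm divide_simps power2_eq_square mult_ac split: if_splits)
    moreover have "((\<lambda>y. \<bar>C\<bar> * dist y x) \<longlongrightarrow> 0) (at x)"
      by (rule tendsto_eq_intros refl tendsto_ident_at)+ simp
    ultimately have "(h bs has_derivative (\<lambda>_. 0)) (at x)"
      by (intro has_derivativeI_sandwich[where e=1 and H="\<lambda>y. \<bar>C\<bar> * dist y x"]) auto
    then show ?thesis using False by simp
  qed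
  show "iter_partial bs (h []) = h bs"
    using assms(4)
  proof (induction bs)
    case (Cons b bs)
    have "frechet_derivative (h bs) (at x) b = h (b # bs) x" for x
      using frechet_derivative_at[OF deriv[of bs x]] Cons.prems
      by (auto simp: h_def fun_eq_iff split: if_splits)
    then show ?case using Cons by simp
  qed simp
  show "h bs differentiable (at x)" using deriv[OF assms(4)] unfolding differentiable_def by blast
qed

text \<open>The weight dominates the norm inside \<open>U\<close>, and outside all partials of the
  zero extension vanish, so decay on \<open>U\<close> bounds the global seminorms.\<close>

lemma pullback_schwartz:
  fixes U :: "'a::euclidean_space set"
  assumes U: "open U" and F: "F \<subseteq> schwartz_functions"
    and est: "\<And>m. diff_estimate (rapid F U) F U m (\<lambda>s x. s (\<phi> x))"
  shows "s \<in> F \<Longrightarrow> pullback U \<phi> s \<in> schwartz_functions_on U"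
    and "set bs \<subseteq> Basis \<Longrightarrow> \<exists>n C. \<forall>s\<in>F. schwartz_seminorm k bs (pullback U \<phi> s) \<le> C * schwartz_size n s"
proof -
  interpret estimate U F "rapid F U" by (rule estimate_rapid[OF F])
  have rapid: "rapid F U (\<lambda>s. iter_partial bs (\<lambda>x. s (\<phi> x)))" if "set bs \<subseteq> Basis" for bs
    using est_iter_partial(1)[OF U est that] by (rule diff_estimate_order_0)
  have diff: "iter_partial bs (\<lambda>x. s (\<phi> x)) differentiable (at x)"
    if "set bs \<subseteq> Basis" "s \<in> F" "x \<in> U" for bs s x
    using est_iter_partial(2)[OF U est that] .
  have decay: "\<exists>n C. \<forall>s\<in>F. \<forall>x\<in>U.
      boundary_weight U x ^ N * \<bar>iter_partial bs (\<lambda>x. s (\<phi> x)) x\<bar> \<le> C * schwartz_size n s"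
    if "set bs \<subseteq> Basis" for bs N
    using rapid[OF that] unfolding rapid_def by blast
  have decay2: "\<exists>C. \<forall>x\<in>U. boundary_weight U x ^ 2 * \<bar>iter_partial bs (\<lambda>x. s (\<phi> x)) x\<bar> \<le> C"
    if "set bs \<subseteq> Basis" "s \<in> F" for bs s
    using decay[OF that(1), of 2] that(2) by blast
  have ext: "iter_partial bs (pullback U \<phi> s) =
      (\<lambda>x. if x \<in> U then iter_partial bs (\<lambda>x. s (\<phi> x)) x else 0)"
    "iter_partial bs (pullback U \<phi> s) differentiable (at x)"
    if "set bs \<subseteq> Basis" "s \<in> F" for bs s x
    using zero_extension[OF U diff[OF _ that(2)] decay2[OF _ that(2)] that(1)]
    unfolding iter_partial.simps(1) pullback_def by simp_all
  have *: "\<exists>n C. \<forall>s\<in>F. \<forall>x. norm x ^ k * \<bar>iter_partial bs (pullback U \<phi> s) x\<bar> \<le> C * schwartz_size n s"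
    if bs: "set bs \<subseteq> Basis" for k bs
  proof -
    obtain n C where C: "0 \<le> C" "\<And>s x. s \<in> F \<Longrightarrow> x \<in> U \<Longrightarrow>
      boundary_weight U x ^ k * \<bar>iter_partial bs (\<lambda>x. s (\<phi> x)) x\<bar> \<le> C * schwartz_size n s"
      using rapidD[OF rapid[OF bs]] F by (metis order_refl)
    have "norm x ^ k * \<bar>iter_partial bs (pullback U \<phi> s) x\<bar> \<le> C * schwartz_size n s" if s: "s \<in> F" for s x
    proof (cases "x \<in> U")
      case True
      have "norm x ^ k * \<bar>iter_partial bs (\<lambda>x. s (\<phi> x)) x\<bar> \<le>
          boundary_weight U x ^ k * \<bar>iter_partial bs (\<lambda>x. s (\<phi> x)) x\<bar>"
        by (intro mult_right_mono power_mono boundary_weight_ge_norm) auto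
      then show ?thesis using C(2)[OF s True] ext(1)[OF bs s] True by simp
    next
      case False
      have "0 \<le> C * schwartz_size n s" using C(1) schwartz_size_nonneg F s by (metis mult_nonneg_nonneg subsetD)
      then show ?thesis using ext(1)[OF bs s] False by simp
    qed
    then show ?thesis by blast
  qed
  show "\<exists>n C. \<forall>s\<in>F. schwartz_seminorm k bs (pullback U \<phi> s) \<le> C * schwartz_size n s"
    if "set bs \<subseteq> Basis"
    using *[OF that, of k] by (meson schwartz_seminorm_least)
  show "pullback U \<phi> s \<in> schwartz_functions_on U" if s: "s \<in> F"
    unfolding schwartz_functions_on_def schwartz_functions_def mem_Collect_eq
  proof (intro conjI allI impI)
    show "smooth_on UNIV (pullback U \<phi> s)" unfolding smooth_on_def using ext(2)[OF _ s] by blast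
  next
    fix k bs assume "set bs \<subseteq> (Basis :: 'a set)"
    from *[OF this, of k] s obtain B where
      "\<And>x. norm x ^ k * \<bar>iter_partial bs (pullback U \<phi> s) x\<bar> \<le> B" by blast
    then show "bounded (range (\<lambda>x. norm x ^ k * iter_partial bs (pullback U \<phi> s) x))"
      unfolding bounded_iff by (auto simp: abs_mult)
  next
    fix bs x assume "set bs \<subseteq> (Basis :: 'a set)" "x \<notin> U"
    then show "iter_partial bs (pullback U \<phi> s) x = 0" using ext(1)[OF _ s] by simp
  qed
qed

section \<open>Tempered maps and tempered equivalence\<close>

definition smooth_tempered :: "'a::euclidean_space set \<Rightarrow> ('a \<Rightarrow> real) \<Rightarrow> bool" where
  "smooth_tempered U h \<longleftrightarrow> (\<forall>m. tempered_order U m h)"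

definition tempered_map ::
  "'a::euclidean_space set \<Rightarrow> 'b::euclidean_space set \<Rightarrow> ('a \<Rightarrow> 'b) \<Rightarrow> bool" where
  "tempered_map U V \<phi> \<longleftrightarrow> (\<forall>x\<in>U. \<phi> x \<in> V) \<and>
     (\<forall>b\<in>Basis. smooth_tempered U (\<lambda>x. \<phi> x \<bullet> b)) \<and>
     tempered U (\<lambda>x. boundary_weight V (\<phi> x))"

lemma smooth_tempered_compose:
  assumes "smooth_tempered V f" "tempered_map U V \<phi>"
  shows "smooth_tempered U (\<lambda>x. f (\<phi> x))"
  unfolding smooth_tempered_def
proof
  fix m
  show "tempered_order U m (\<lambda>x. f (\<phi> x))"
  proof (rule est_compose[where R="\<lambda>f. tempered V (f ())" and V=V])
    show "tempered U (\<lambda>x. g () (\<phi> x))" if "tempered V (g ())" for g :: "unit \<Rightarrow> 'a \<Rightarrow> real"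
      by (rule tempered_compose[where V=V and h="g ()" and \<phi>=\<phi>])
        (use that assms(2) in \<open>simp_all add: tempered_map_def\<close>)
  qed (use assms in \<open>simp_all add: smooth_tempered_def tempered_map_def tempered.estimate_axioms\<close>)
qed

lemma tempered_map_compose:
  assumes "tempered_map U V \<phi>" "tempered_map V W \<psi>"
  shows "tempered_map U W (\<lambda>x. \<psi> (\<phi> x))"
proof -
  have "tempered U (\<lambda>x. boundary_weight W (\<psi> (\<phi> x)))"
    by (rule tempered_compose[where V=V and h="\<lambda>y. boundary_weight W (\<psi> y)" and \<phi>=\<phi>])
      (use assms in \<open>simp_all add: tempered_map_def\<close>)
  moreover have "smooth_tempered U (\<lambda>x. \<psi> (\<phi> x) \<bullet> b)" if "b \<in> Basis" for b
    using smooth_tempered_compose[OF _ assms(1), of "\<lambda>y. \<psi> y \<bullet> b"] assms(2) that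
    by (simp add: tempered_map_def)
  ultimately show ?thesis using assms by (simp add: tempered_map_def)
qed

text \<open>Vector-valued smoothness is read off the real components. The separate \<open>g\<close>
  makes room for \<open>inv_into U \<phi>\<close>, which is known to agree with the inverse map only
  on its domain.\<close>

lemma smooth_on_tempered_map:
  fixes \<phi> :: "'a::euclidean_space \<Rightarrow> 'b::euclidean_space"
  assumes U: "open U" and \<phi>: "tempered_map U V \<phi>"
    and eq: "\<And>x. x \<in> U \<Longrightarrow> g x = \<phi> x"
  shows "smooth_on U g"
proof -
  have diff: "iter_partial bs (\<lambda>x. \<phi> x \<bullet> b) differentiable (at x)"
    if "set bs \<subseteq> Basis" "b \<in> Basis" "x \<in> U" for bs b x
    by (rule tempered.est_iter_partial(2)[where i="()" and f="\<lambda>_ x. \<phi> x \<bullet> b" and U=U])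
      (use \<phi> U that in \<open>auto simp: tempered_map_def smooth_tempered_def\<close>)
  have *: "\<forall>x\<in>U. iter_partial bs g x = (\<Sum>b\<in>Basis. iter_partial bs (\<lambda>x. \<phi> x \<bullet> b) x *\<^sub>R b)"
    if "set bs \<subseteq> Basis" for bs
    using that
  proof (induction bs)
    case Nil
    then show ?case using eq by (simp add: euclidean_representation)
  next
    case (Cons c bs)
    show ?case
    proof
      fix x assume x: "x \<in> U"
      have "((\<lambda>x. \<Sum>b\<in>Basis. iter_partial bs (\<lambda>x. \<phi> x \<bullet> b) x *\<^sub>R b) has_derivative
         (\<lambda>h. \<Sum>b\<in>Basis. frechet_derivative (iter_partial bs (\<lambda>x. \<phi> x \<bullet> b)) (at x) h *\<^sub>R b)) (at x)"
        using diff[OF _ _ x] Cons.prems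
        by (intro has_derivative_sum has_derivative_scaleR_left)
          (simp add: frechet_derivative_works[symmetric])
      then have "(iter_partial bs g has_derivative
         (\<lambda>h. \<Sum>b\<in>Basis. frechet_derivative (iter_partial bs (\<lambda>x. \<phi> x \<bullet> b)) (at x) h *\<^sub>R b)) (at x)"
        by (rule has_derivative_transform_within_open[OF _ U x]) (use Cons in simp)
      from frechet_derivative_at[OF this, symmetric]
      show "iter_partial (c # bs) g x = (\<Sum>b\<in>Basis. iter_partial (c # bs) (\<lambda>x. \<phi> x \<bullet> b) x *\<^sub>R b)"
        by simp
    qed
  qed
  show ?thesis unfolding smooth_on_def
  proof (intro allI impI ballI)
    fix bs x assume bs: "set bs \<subseteq> (Basis :: 'a set)" and x: "x \<in> U"
    have "(\<lambda>x. \<Sum>b\<in>Basis. iter_partial bs (\<lambda>x. \<phi> x \<bullet> b) x *\<^sub>R b) differentiable (at x)"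
      using diff[OF bs _ x] by (intro derivative_intros) auto
    then obtain D where "((\<lambda>x. \<Sum>b\<in>Basis. iter_partial bs (\<lambda>x. \<phi> x \<bullet> b) x *\<^sub>R b) has_derivative D) (at x)"
      unfolding differentiable_def by blast
    then have "(iter_partial bs g has_derivative D) (at x)"
      by (rule has_derivative_transform_within_open[OF _ U x]) (use *[OF bs] in simp)
    then show "iter_partial bs g differentiable (at x)" unfolding differentiable_def by blast
  qed
qed

text \<open>\<open>\<phi>\<close> supplies the derivative bounds for the chain rule and
  \<open>\<psi>\<close> the comparison of weights for \<open>rapid_compose\<close>; one uniform
  estimate then yields both conclusions.\<close>

lemma pullback_tempered_map:
  fixes U V :: "'a::euclidean_space set"
  assumes U: "open U" and V: "open V" "V \<noteq> UNIV"
    and \<phi>: "tempered_map U V \<phi>" and \<psi>: "tempered_map V U \<psi>"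
    and inv: "\<And>x. x \<in> U \<Longrightarrow> \<psi> (\<phi> x) = x"
  shows "s \<in> schwartz_functions_on V \<Longrightarrow> pullback U \<phi> s \<in> schwartz_functions_on U"
    and "continuous_map (schwartz_topology_on V) (schwartz_topology_on U) (pullback U \<phi>)"
proof -
  let ?F = "schwartz_functions_on V"
  have est: "diff_estimate (rapid ?F U) ?F U m (\<lambda>s x. s (\<phi> x))" for m
  proof (rule est_compose[where R="rapid ?F V" and V=V])
    show "estimate U ?F (rapid ?F U)" by (rule estimate_rapid[OF schwartz_functions_on_subset])
    show "diff_estimate (rapid ?F V) ?F V m (\<lambda>s. s)" by (rule est_rapid_schwartz[OF V])
    show "rapid ?F U (\<lambda>s x. T s (\<phi> x))" if "rapid ?F V T" for T
      by (rule rapid_compose[OF that, where \<psi>=\<psi>]) (use \<phi> \<psi> inv in \<open>auto simp: tempered_map_def\<close>)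
  qed (use \<phi> in \<open>auto simp: tempered_map_def smooth_tempered_def\<close>)
  note pb = pullback_schwartz[OF U schwartz_functions_on_subset est]
  show "s \<in> ?F \<Longrightarrow> pullback U \<phi> s \<in> schwartz_functions_on U" by (rule pb)
  show "continuous_map (schwartz_topology_on V) (schwartz_topology_on U) (pullback U \<phi>)"
    by (rule continuous_map_schwartz) (use pb in \<open>auto simp: pullback_def fun_eq_iff\<close>)
qed

definition tempered_equivalent :: "'a::euclidean_space set \<Rightarrow> 'b::euclidean_space set \<Rightarrow> bool" where
  "tempered_equivalent U V \<longleftrightarrow> (\<exists>\<phi> \<psi>. tempered_map U V \<phi> \<and> tempered_map V U \<psi> \<and>
     (\<forall>x\<in>U. \<psi> (\<phi> x) = x) \<and> (\<forall>y\<in>V. \<phi> (\<psi> y) = y))"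

lemma tempered_equivalentI:
  assumes "tempered_map U V \<phi>" "tempered_map V U \<psi>"
    and "\<And>x. x \<in> U \<Longrightarrow> \<psi> (\<phi> x) = x" "\<And>y. y \<in> V \<Longrightarrow> \<phi> (\<psi> y) = y"
  shows "tempered_equivalent U V"
  using assms unfolding tempered_equivalent_def by blast

lemma tempered_equivalent_trans:
  assumes "tempered_equivalent U V" "tempered_equivalent V W"
  shows "tempered_equivalent U W"
proof -
  obtain \<phi> \<psi> where 1: "tempered_map U V \<phi>" "tempered_map V U \<psi>"
    "\<And>x. x \<in> U \<Longrightarrow> \<psi> (\<phi> x) = x" "\<And>y. y \<in> V \<Longrightarrow> \<phi> (\<psi> y) = y"
    using assms(1) unfolding tempered_equivalent_def by blast
  obtain \<phi>' \<psi>' where 2: "tempered_map V W \<phi>'" "tempered_map W V \<psi>'"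
    "\<And>x. x \<in> V \<Longrightarrow> \<psi>' (\<phi>' x) = x" "\<And>y. y \<in> W \<Longrightarrow> \<phi>' (\<psi>' y) = y"
    using assms(2) unfolding tempered_equivalent_def by blast
  have mem: "\<And>x. x \<in> U \<Longrightarrow> \<phi> x \<in> V" "\<And>y. y \<in> W \<Longrightarrow> \<psi>' y \<in> V"
    using 1(1) 2(2) by (auto simp: tempered_map_def)
  show ?thesis
    by (rule tempered_equivalentI[OF tempered_map_compose[OF 1(1) 2(1)] tempered_map_compose[OF 2(2) 1(2)]])
      (simp_all add: 1 2 mem)
qed

text \<open>The hypotheses are symmetric in \<open>U\<close> and \<open>V\<close>, so both pullbacks
  are continuous by the same estimate, without an appeal to the open mapping theorem.\<close>

theorem schwartz_equivalent_if_tempered_equivalent: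
  fixes U V :: "'a::euclidean_space set"
  assumes U: "open U" "U \<noteq> UNIV" and V: "open V" "V \<noteq> UNIV"
    and "tempered_equivalent U V"
  shows "schwartz_equivalent U V"
proof -
  obtain \<phi> \<psi> where \<phi>: "tempered_map U V \<phi>" and \<psi>: "tempered_map V U \<psi>"
    and inv: "\<And>x. x \<in> U \<Longrightarrow> \<psi> (\<phi> x) = x" "\<And>y. y \<in> V \<Longrightarrow> \<phi> (\<psi> y) = y"
    using assms(5) unfolding tempered_equivalent_def by blast
  have mem: "\<And>x. x \<in> U \<Longrightarrow> \<phi> x \<in> V" "\<And>y. y \<in> V \<Longrightarrow> \<psi> y \<in> U"
    using \<phi> \<psi> by (auto simp: tempered_map_def)
  have bij: "bij_betw \<phi> U V" using inv mem by (intro bij_betwI[where g=\<psi>]) auto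
  have inv_into: "inv_into U \<phi> y = \<psi> y" if "y \<in> V" for y
    using that inv mem bij by (intro inv_into_f_eq) (auto simp: bij_betw_def)
  have diffeo: "smooth_diffeomorphism U V \<phi>"
    unfolding smooth_diffeomorphism_def
    using bij smooth_on_tempered_map[OF U(1) \<phi>] smooth_on_tempered_map[OF V(1) \<psi> inv_into] by blast
  have "homeomorphic_maps (schwartz_topology_on V) (schwartz_topology_on U) (pullback U \<phi>) (pullback V \<psi>)"
    unfolding homeomorphic_maps_def topspace_schwartz_topology_on
  proof (intro conjI ballI)
    \<comment> \<open>Elements of the Schwartz space vanish off \<open>W\<close>, so the zero that
      \<open>pullback\<close> puts there loses nothing.\<close>
    have zero: "s x = 0" if "s \<in> schwartz_functions_on W" "x \<notin> W" for W s and x :: 'a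
      using that by (force simp: schwartz_functions_on_def dest!: spec[of _ "[]"])
    show "pullback V \<psi> (pullback U \<phi> s) = s" if "s \<in> schwartz_functions_on V" for s
      using zero[OF that] mem inv by (auto simp: pullback_def fun_eq_iff)
    show "pullback U \<phi> (pullback V \<psi> s) = s" if "s \<in> schwartz_functions_on U" for s
      using zero[OF that] mem inv by (auto simp: pullback_def fun_eq_iff)
  qed (use pullback_tempered_map(2)[OF U(1) V \<phi> \<psi>] pullback_tempered_map(2)[OF V(1) U \<psi> \<phi>] inv in auto)
  then have "homeomorphic_map (schwartz_topology_on V) (schwartz_topology_on U) (pullback U \<phi>)"
    by (rule homeomorphic_maps_imp_map)
  then have "schwartz_space_isomorphism V U (pullback U \<phi>)"
    unfolding schwartz_space_isomorphism_def by (auto simp: pullback_def fun_eq_iff)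
  with diffeo show ?thesis using U(1) V(1) unfolding schwartz_equivalent_def by blast
qed

section \<open>Closure properties of tempered functions\<close>

lemma smooth_tempered_tempered: "smooth_tempered U f \<Longrightarrow> tempered U f"
  unfolding smooth_tempered_def by (metis diff_estimate.simps(1))

text \<open>For functions whose derivatives are expressed through the function itself, such as
  exponentials and reciprocals: then the order gained by one differentiation closes the induction.\<close>

lemma smooth_tempered_bootstrap:
  assumes "tempered U f" "\<And>x. x \<in> U \<Longrightarrow> (f has_derivative D x) (at x)"
    and "\<And>m b. b \<in> Basis \<Longrightarrow> tempered_order U m f \<Longrightarrow> tempered_order U m (\<lambda>x. D x b)"
  shows "smooth_tempered U f"
  unfolding smooth_tempered_def
proof
  fix m show "tempered_order U m f"
  proof (induction m)
    case (Suc m)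
    show ?case by (rule tempered_order_SucI[OF assms(1,2)]) (use assms(3) Suc in auto)
  qed (use assms in simp)
qed

lemma smooth_temperedI:
  assumes "tempered U f" "\<And>x. x \<in> U \<Longrightarrow> (f has_derivative D x) (at x)"
    and "\<And>b. b \<in> Basis \<Longrightarrow> smooth_tempered U (\<lambda>x. D x b)"
  shows "smooth_tempered U f"
  using assms by (intro smooth_tempered_bootstrap[where D=D]) (auto simp: smooth_tempered_def)

text \<open>The derivative hidden in \<open>tempered_order\<close> could be a different witness for
  each order; \<open>frechet_derivative\<close> is one choice that serves all of them.\<close>

lemma smooth_tempered_derivative:
  assumes "open U" "smooth_tempered U f"
  obtains D where "\<And>x. x \<in> U \<Longrightarrow> (f has_derivative D x) (at x)"
    "\<And>b. b \<in> Basis \<Longrightarrow> smooth_tempered U (\<lambda>x. D x b)"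
proof
  fix x assume "x \<in> U"
  have "tempered_order U 1 f" using assms(2) by (simp only: smooth_tempered_def)
  then have "f differentiable (at x)" using \<open>x \<in> U\<close> by (auto simp: differentiable_def)
  then show "(f has_derivative frechet_derivative f (at x)) (at x)"
    by (simp only: frechet_derivative_works)
next
  fix b :: 'a assume b: "b \<in> Basis"
  have "tempered_order U m (iter_partial [b] f)" for m
    by (rule tempered.est_iter_partial(1)[where f="\<lambda>_. f"])
      (use assms b in \<open>simp_all add: smooth_tempered_def\<close>)
  then show "smooth_tempered U (\<lambda>x. frechet_derivative f (at x) b)"
    by (simp add: smooth_tempered_def)
qed

lemma smooth_tempered_const: "smooth_tempered U (\<lambda>x. c)"
  by (rule smooth_tempered_bootstrap[where D="\<lambda>_ _. 0"])
    (auto intro: tempered_const tempered.est_zero)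

lemma smooth_tempered_linear:
  assumes "bounded_linear f"
  shows "smooth_tempered U f"
proof (rule smooth_temperedI)
  interpret bounded_linear f by fact
  obtain K where K: "0 \<le> K" "\<And>x. norm (f x) \<le> norm x * K" using nonneg_bounded by blast
  show "tempered U f"
  proof (rule temperedI[where C=K and k=1])
    fix x assume "x \<in> U"
    have "norm x * K \<le> boundary_weight U x * K"
      using K(1) by (intro mult_right_mono boundary_weight_ge_norm)
    then show "\<bar>f x\<bar> \<le> K * boundary_weight U x ^ 1" using K(2)[of x] by (simp add: mult.commute)
  qed
qed (use assms in \<open>auto intro: smooth_tempered_const bounded_linear_imp_has_derivative\<close>)

lemma smooth_tempered_add:
  "smooth_tempered U f \<Longrightarrow> smooth_tempered U g \<Longrightarrow> smooth_tempered U (\<lambda>x. f x + g x)"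
  unfolding smooth_tempered_def by (auto intro: tempered.est_add)

lemma smooth_tempered_mult:
  "smooth_tempered U f \<Longrightarrow> smooth_tempered U g \<Longrightarrow> smooth_tempered U (\<lambda>x. f x * g x)"
  unfolding smooth_tempered_def by (auto intro: tempered.est_mult)

lemma smooth_tempered_minus: "smooth_tempered U f \<Longrightarrow> smooth_tempered U (\<lambda>x. - f x)"
  using smooth_tempered_mult[OF smooth_tempered_const[of U "-1"]] by simp

lemma smooth_tempered_diff:
  "smooth_tempered U f \<Longrightarrow> smooth_tempered U g \<Longrightarrow> smooth_tempered U (\<lambda>x. f x - g x)"
  using smooth_tempered_add[OF _ smooth_tempered_minus, of U f g] by simp

lemma smooth_tempered_power: "smooth_tempered U f \<Longrightarrow> smooth_tempered U (\<lambda>x. f x ^ k)"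
  by (induction k) (auto intro: smooth_tempered_const smooth_tempered_mult)

lemma smooth_tempered_poly: "smooth_tempered U f \<Longrightarrow> smooth_tempered U (\<lambda>x. poly p (f x))"
  by (induction p) (auto intro: smooth_tempered_const smooth_tempered_mult smooth_tempered_add)

lemma smooth_tempered_cong:
  assumes "open U" "\<And>x. x \<in> U \<Longrightarrow> f x = g x" "smooth_tempered U f"
  shows "smooth_tempered U g"
  unfolding smooth_tempered_def
proof
  fix m show "tempered_order U m g"
    by (rule tempered.est_cong[OF assms(1), where f="\<lambda>_. f"])
      (use assms in \<open>auto simp: smooth_tempered_def\<close>)
qed

lemma smooth_tempered_exp:
  assumes "open U" "smooth_tempered U f" "tempered U (\<lambda>x. exp (f x))"
  shows "smooth_tempered U (\<lambda>x. exp (f x))"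
proof -
  obtain D where D: "\<And>x. x \<in> U \<Longrightarrow> (f has_derivative D x) (at x)"
    "\<And>b. b \<in> Basis \<Longrightarrow> smooth_tempered U (\<lambda>x. D x b)"
    using smooth_tempered_derivative[OF assms(1,2)] by blast
  show ?thesis
  proof (rule smooth_tempered_bootstrap[OF assms(3)])
    show "((\<lambda>x. exp (f x)) has_derivative (\<lambda>h. exp (f x) * D x h)) (at x)" if "x \<in> U" for x
      using has_derivative_exp[OF D(1)[OF that]] by (simp add: mult.commute)
    show "tempered_order U m (\<lambda>x. exp (f x) * D x b)"
      if "b \<in> Basis" "tempered_order U m (\<lambda>x. exp (f x))" for m b
      using tempered.est_mult[OF that(2), of "\<lambda>x. D x b"] D(2)[OF that(1)] by (simp add: smooth_tempered_def)
  qed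
qed

lemma smooth_tempered_inverse:
  assumes "open U" "smooth_tempered U f" "tempered U (\<lambda>x. inverse (f x))"
    and nz: "\<And>x. x \<in> U \<Longrightarrow> f x \<noteq> 0"
  shows "smooth_tempered U (\<lambda>x. inverse (f x))"
proof -
  obtain D where D: "\<And>x. x \<in> U \<Longrightarrow> (f has_derivative D x) (at x)"
    "\<And>b. b \<in> Basis \<Longrightarrow> smooth_tempered U (\<lambda>x. D x b)"
    using smooth_tempered_derivative[OF assms(1,2)] by blast
  show ?thesis
  proof (rule smooth_tempered_bootstrap[OF assms(3)])
    show "((\<lambda>x. inverse (f x)) has_derivative (\<lambda>h. inverse (f x) * inverse (f x) * (- D x h))) (at x)"
      if "x \<in> U" for x
      using Deriv.has_derivative_inverse[OF nz[OF that] D(1)[OF that]] by (simp add: mult_ac)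
    show "tempered_order U m (\<lambda>x. inverse (f x) * inverse (f x) * (- D x b))"
      if b: "b \<in> Basis" and f: "tempered_order U m (\<lambda>x. inverse (f x))" for m b
      using tempered.est_mult[OF tempered.est_mult[OF f f], of "\<lambda>x. - D x b"]
        smooth_tempered_minus[OF D(2)[OF b]] by (simp add: smooth_tempered_def)
  qed
qed

lemma smooth_tempered_divide:
  assumes "open U" "smooth_tempered U g" "smooth_tempered U f" "tempered U (\<lambda>x. inverse (f x))"
    and "\<And>x. x \<in> U \<Longrightarrow> f x \<noteq> 0"
  shows "smooth_tempered U (\<lambda>x. g x / f x)"
  using smooth_tempered_mult[OF assms(2) smooth_tempered_inverse[OF assms(1,3,4,5)]]
  by (simp add: divide_inverse)

lemma smooth_tempered_ln:
  assumes "open U" "smooth_tempered U f" "tempered U (\<lambda>x. inverse (f x))"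
    and pos: "\<And>x. x \<in> U \<Longrightarrow> 0 < f x"
  shows "smooth_tempered U (\<lambda>x. ln (f x))"
proof -
  obtain D where D: "\<And>x. x \<in> U \<Longrightarrow> (f has_derivative D x) (at x)"
    "\<And>b. b \<in> Basis \<Longrightarrow> smooth_tempered U (\<lambda>x. D x b)"
    using smooth_tempered_derivative[OF assms(1,2)] by blast
  have inv: "smooth_tempered U (\<lambda>x. inverse (f x))"
    using assms pos by (intro smooth_tempered_inverse) force+
  show ?thesis
  proof (rule smooth_temperedI[where D="\<lambda>x h. D x h * inverse (f x)"])
    show "tempered U (\<lambda>x. ln (f x))"
    proof (rule tempered_mono[OF tempered_add[OF smooth_tempered_tempered[OF assms(2)] assms(3)]])
      fix x assume "x \<in> U"
      then have "0 < f x" by (rule pos)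
      then show "\<bar>ln (f x)\<bar> \<le> \<bar>f x + inverse (f x)\<bar>"
        using ln_le_minus_one[of "f x"] ln_le_minus_one[of "inverse (f x)"]
        by (smt (verit) ln_inverse positive_imp_inverse_positive)
    qed
    show "((\<lambda>x. ln (f x)) has_derivative (\<lambda>h. D x h * inverse (f x))) (at x)" if "x \<in> U" for x
      using has_derivative_ln[OF pos[OF that] D(1)[OF that]] .
  qed (use D inv in \<open>auto intro: smooth_tempered_mult\<close>)
qed

text \<open>For exponents between zero and one the power is at most \<open>1 + f x\<close>, hence
  tempered along with \<open>f\<close>. The uses are square roots and \<open>n\<close>-th
  roots.\<close>

lemma smooth_tempered_powr:
  assumes "open U" "smooth_tempered U f" "tempered U (\<lambda>x. inverse (f x))"
    and pos: "\<And>x. x \<in> U \<Longrightarrow> 0 < f x" and a: "0 \<le> a" "a \<le> 1"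
  shows "smooth_tempered U (\<lambda>x. f x powr a)"
proof (rule smooth_tempered_cong[OF assms(1)])
  show "exp (a * ln (f x)) = f x powr a" if "x \<in> U" for x
    using pos[OF that] by (simp add: powr_def)
  show "smooth_tempered U (\<lambda>x. exp (a * ln (f x)))"
  proof (rule smooth_tempered_exp[OF assms(1)])
    show "smooth_tempered U (\<lambda>x. a * ln (f x))"
      by (rule smooth_tempered_mult[OF smooth_tempered_const smooth_tempered_ln[OF assms(1-4)]])
    show "tempered U (\<lambda>x. exp (a * ln (f x)))"
    proof (rule tempered_mono[OF tempered_add[OF tempered_const[of _ 1] smooth_tempered_tempered[OF assms(2)]]])
      fix x assume "x \<in> U"
      then have f: "0 < f x" by (rule pos)
      have "f x powr a \<le> (1 + f x) powr a" using f a by (intro powr_mono2) auto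
      also have "\<dots> \<le> (1 + f x) powr 1" using f a by (intro powr_mono) auto
      finally show "\<bar>exp (a * ln (f x))\<bar> \<le> \<bar>1 + f x\<bar>" using f by (simp add: powr_def)
    qed
  qed
qed

lemma smooth_tempered_sqrt:
  assumes "open U" "smooth_tempered U f" "tempered U (\<lambda>x. inverse (f x))"
    and pos: "\<And>x. x \<in> U \<Longrightarrow> 0 < f x"
  shows "smooth_tempered U (\<lambda>x. sqrt (f x))"
  by (rule smooth_tempered_cong[OF assms(1) _ smooth_tempered_powr[OF assms, of "1/2"]])
    (use pos in \<open>auto simp: powr_half_sqrt less_imp_le\<close>)

lemma smooth_tempered_fst: "smooth_tempered U fst"
  by (rule smooth_tempered_linear[OF bounded_linear_fst])

lemma smooth_tempered_snd: "smooth_tempered U snd"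
  by (rule smooth_tempered_linear[OF bounded_linear_snd])

lemmas smooth_tempered_intros =
  smooth_tempered_const smooth_tempered_fst smooth_tempered_snd smooth_tempered_add
  smooth_tempered_mult smooth_tempered_diff smooth_tempered_minus smooth_tempered_power
  smooth_tempered_poly

lemmas tempered_intros =
  smooth_tempered_tempered[OF smooth_tempered_fst] smooth_tempered_tempered[OF smooth_tempered_snd]
  tempered_const tempered_add tempered_mult tempered_power

section \<open>Weights of planar domains\<close>

text \<open>\<open>h\<close> is any tempered bound for the reciprocal distance from the image point
  to points outside \<open>V\<close>; the infimum defining \<open>infdist\<close> inherits
  it.\<close>

lemma tempered_map_Pair:
  fixes f g :: "'a::euclidean_space \<Rightarrow> real"
  assumes "\<And>x. x \<in> U \<Longrightarrow> (f x, g x) \<in> V" "V \<noteq> UNIV"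
    and f: "smooth_tempered U f" and g: "smooth_tempered U g"
    and h: "tempered U h" "\<And>x z. x \<in> U \<Longrightarrow> z \<notin> V \<Longrightarrow> 1 \<le> h x * dist (f x, g x) z"
  shows "tempered_map U V (\<lambda>x. (f x, g x))"
  unfolding tempered_map_def
proof (intro conjI ballI)
  have "tempered U (\<lambda>x. 1 + \<bar>f x\<bar> + \<bar>g x\<bar> + h x)"
    using tempered_mono[OF smooth_tempered_tempered[OF f], of "\<lambda>x. \<bar>f x\<bar>"]
      tempered_mono[OF smooth_tempered_tempered[OF g], of "\<lambda>x. \<bar>g x\<bar>"] h(1)
    by (auto intro!: tempered_add tempered_const)
  then show "tempered U (\<lambda>x. boundary_weight V (f x, g x))"
  proof (rule tempered_mono)
    fix x assume x: "x \<in> U"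
    \<comment> \<open>An outside point forces \<open>h x\<close> to be positive and makes the
      infimum range over a nonempty set.\<close>
    obtain z0 where z0: "z0 \<notin> V" using assms(2) by auto
    have "0 < h x * dist (f x, g x) z0" using h(2)[OF x z0] by linarith
    then have hx: "0 < h x" by (simp add: zero_less_mult_iff not_less[symmetric])
    have "inverse (h x) \<le> dist (f x, g x) z" if "z \<in> - V" for z
      using h(2)[OF x, of z] that hx by (simp add: inverse_eq_divide pos_divide_le_eq mult.commute)
    then have "inverse (h x) \<le> infdist (f x, g x) (- V)"
      unfolding infdist_def using z0 by (auto intro!: cINF_greatest)
    then have "inverse (infdist (f x, g x) (- V)) \<le> h x"
      using hx le_imp_inverse_le[of "inverse (h x)"] by simp
    then show "\<bar>boundary_weight V (f x, g x)\<bar> \<le> \<bar>1 + \<bar>f x\<bar> + \<bar>g x\<bar> + h x\<bar>"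
      using norm_Pair_le[of "f x" "g x"] boundary_weight_ge_1[of V "(f x, g x)"]
      by (simp add: boundary_weight_def)
  qed
qed (use assms in \<open>auto simp: Basis_prod_def\<close>)

text \<open>The counterpart on the source side: an outside point within \<open>c x\<close> keeps the
  distance to the complement below \<open>c x\<close>, so the weight dominates the
  reciprocal.\<close>

lemma tempered_inverse:
  assumes "open U" "\<And>x. x \<in> U \<Longrightarrow> 0 < c x"
    and "\<And>x. x \<in> U \<Longrightarrow> \<exists>z. z \<notin> U \<and> dist x z \<le> c x"
  shows "tempered U (\<lambda>x. inverse (c x))"
proof (rule tempered_mono[OF tempered_weight])
  fix x assume x: "x \<in> U"
  obtain z where "z \<notin> U" "dist x z \<le> c x" using assms(3)[OF x] by blast
  then have "inverse (c x) \<le> boundary_weight U x" using inverse_le_boundary_weight assms(1) x by blast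
  then show "\<bar>inverse (c x)\<bar> \<le> \<bar>boundary_weight U x\<bar>" using assms(2)[OF x] by simp
qed

text \<open>Meant for domains cut out by three inequalities: \<open>a\<close>, \<open>b\<close>,
  \<open>c\<close> are the slacks at an inside point, and leaving the domain uses up at least one of
  them.\<close>

lemma one_le_sum_inverse_mult:
  fixes a b c d :: real
  assumes "0 < a" "0 < b" "0 < c" "a \<le> d \<or> b \<le> d \<or> c \<le> d"
  shows "1 \<le> (inverse a + inverse b + inverse c) * d"
proof -
  have "0 < d" using assms by linarith
  then have "inverse d \<le> inverse a + inverse b + inverse c"
    using assms le_imp_inverse_le[of a d] le_imp_inverse_le[of b d] le_imp_inverse_le[of c d]
      positive_imp_inverse_positive[of a] positive_imp_inverse_positive[of b] positive_imp_inverse_positive[of c]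
    by linarith
  then have "inverse d * d \<le> (inverse a + inverse b + inverse c) * d"
    using \<open>0 < d\<close> by (intro mult_right_mono) auto
  then show ?thesis using \<open>0 < d\<close> by simp
qed

definition half_strip :: "(real \<times> real) set" where
  "half_strip = {z. 1 < fst z \<and> 0 < snd z \<and> snd z < 1}"

definition square :: "(real \<times> real) set" where
  "square = {z. \<bar>fst z\<bar> < 1 \<and> \<bar>snd z\<bar> < 1}"

lemma open_half_strip: "open half_strip"
  unfolding half_strip_def
  by (intro open_Collect_conj open_Collect_less continuous_intros)

lemma open_square: "open square"
  unfolding square_def
  by (intro open_Collect_conj open_Collect_less continuous_intros)

lemma half_strip_neq_UNIV: "half_strip \<noteq> UNIV"
proof -
  have "(1, 1) \<notin> half_strip" by (simp add: half_strip_def)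
  then show ?thesis by blast
qed

lemma square_neq_UNIV: "square \<noteq> UNIV"
proof -
  have "(1, 1) \<notin> square" by (simp add: square_def)
  then show ?thesis by blast
qed

lemma half_strip_tempered:
  "tempered half_strip (\<lambda>z. inverse (fst z - 1))"
  "tempered half_strip (\<lambda>z. inverse (snd z))"
  "tempered half_strip (\<lambda>z. inverse (1 - snd z))"
  "tempered half_strip (\<lambda>z. inverse (fst z))"
proof -
  have "\<exists>w. w \<notin> half_strip \<and> dist z w \<le> fst z - 1" if "z \<in> half_strip" for z
    by (rule exI[of _ "(1, snd z)"]) (use that in \<open>auto simp: half_strip_def dist_prod_def dist_real_def\<close>)
  then show 1: "tempered half_strip (\<lambda>z. inverse (fst z - 1))"
    by (intro tempered_inverse open_half_strip) (auto simp: half_strip_def)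
  have "\<exists>w. w \<notin> half_strip \<and> dist z w \<le> snd z" if "z \<in> half_strip" for z
    by (rule exI[of _ "(fst z, 0)"]) (use that in \<open>auto simp: half_strip_def dist_prod_def dist_real_def\<close>)
  then show "tempered half_strip (\<lambda>z. inverse (snd z))"
    by (intro tempered_inverse open_half_strip) (auto simp: half_strip_def)
  have "\<exists>w. w \<notin> half_strip \<and> dist z w \<le> 1 - snd z" if "z \<in> half_strip" for z
    by (rule exI[of _ "(fst z, 1)"]) (use that in \<open>auto simp: half_strip_def dist_prod_def dist_real_def\<close>)
  then show "tempered half_strip (\<lambda>z. inverse (1 - snd z))"
    by (intro tempered_inverse open_half_strip) (auto simp: half_strip_def)
  show "tempered half_strip (\<lambda>z. inverse (fst z))"
    by (rule tempered_mono[OF 1]) (auto simp: half_strip_def le_imp_inverse_le)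
qed

lemma half_strip_dist:
  assumes "(a, b) \<in> half_strip" "z \<notin> half_strip"
  shows "1 \<le> (inverse (a - 1) + inverse b + inverse (1 - b)) * dist (a, b) z"
proof (rule one_le_sum_inverse_mult)
  have "\<bar>a - fst z\<bar> \<le> dist (a, b) z" "\<bar>b - snd z\<bar> \<le> dist (a, b) z"
    using dist_fst_le[of "(a,b)" z] dist_snd_le[of "(a,b)" z] by (auto simp: dist_real_def)
  then show "a - 1 \<le> dist (a, b) z \<or> b \<le> dist (a, b) z \<or> 1 - b \<le> dist (a, b) z"
    using assms(2) by (auto simp: half_strip_def)
qed (use assms in \<open>auto simp: half_strip_def\<close>)

lemma square_tempered:
  "tempered square (\<lambda>z. inverse (1 - fst z))" "tempered square (\<lambda>z. inverse (1 + fst z))"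
  "tempered square (\<lambda>z. inverse (1 - snd z))" "tempered square (\<lambda>z. inverse (1 + snd z))"
proof -
  have "\<exists>w. w \<notin> square \<and> dist z w \<le> 1 - fst z" if "z \<in> square" for z
    by (rule exI[of _ "(1, snd z)"]) (use that in \<open>auto simp: square_def dist_prod_def dist_real_def\<close>)
  then show "tempered square (\<lambda>z. inverse (1 - fst z))"
    by (intro tempered_inverse open_square) (auto simp: square_def)
  have "\<exists>w. w \<notin> square \<and> dist z w \<le> 1 + fst z" if "z \<in> square" for z
    by (rule exI[of _ "(-1, snd z)"]) (use that in \<open>auto simp: square_def dist_prod_def dist_real_def\<close>)
  then show "tempered square (\<lambda>z. inverse (1 + fst z))"
    by (intro tempered_inverse open_square) (auto simp: square_def)
  have "\<exists>w. w \<notin> square \<and> dist z w \<le> 1 - snd z" if "z \<in> square" for z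
    by (rule exI[of _ "(fst z, 1)"]) (use that in \<open>auto simp: square_def dist_prod_def dist_real_def\<close>)
  then show "tempered square (\<lambda>z. inverse (1 - snd z))"
    by (intro tempered_inverse open_square) (auto simp: square_def)
  have "\<exists>w. w \<notin> square \<and> dist z w \<le> 1 + snd z" if "z \<in> square" for z
    by (rule exI[of _ "(fst z, -1)"]) (use that in \<open>auto simp: square_def dist_prod_def dist_real_def\<close>)
  then show "tempered square (\<lambda>z. inverse (1 + snd z))"
    by (intro tempered_inverse open_square) (auto simp: square_def)
qed

lemma square_tempered_squares:
  "tempered square (\<lambda>z. inverse (1 - fst z ^ 2))" "tempered square (\<lambda>z. inverse (1 - snd z ^ 2))"
  "tempered square (\<lambda>z. inverse (1 - fst z ^ 2 * snd z ^ 2))"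
proof -
  have eq: "inverse (1 - a ^ 2) = inverse (1 - a) * inverse (1 + a)" for a :: real
    by (simp add: inverse_mult_distrib[symmetric] power2_eq_square algebra_simps)
  show 1: "tempered square (\<lambda>z. inverse (1 - fst z ^ 2))" "tempered square (\<lambda>z. inverse (1 - snd z ^ 2))"
    unfolding eq by (intro tempered_mult square_tempered)+
  show "tempered square (\<lambda>z. inverse (1 - fst z ^ 2 * snd z ^ 2))"
  proof (rule tempered_mono[OF 1(1)])
    fix z assume "z \<in> square"
    then have "fst z ^ 2 < 1" "snd z ^ 2 < 1" by (auto simp: square_def abs_square_less_1)
    moreover from this have "fst z ^ 2 * snd z ^ 2 \<le> fst z ^ 2" by (intro mult_left_le) auto
    ultimately show "\<bar>inverse (1 - fst z ^ 2 * snd z ^ 2)\<bar> \<le> \<bar>inverse (1 - fst z ^ 2)\<bar>"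
      by (auto intro!: le_imp_inverse_le)
  qed
qed

text \<open>Measuring the slacks by squares avoids absolute values;
  \<open>1 - t ^ 2 \<le> 2 * (1 - \<bar>t\<bar>)\<close> makes the conversion at the price of the
  factor \<open>2\<close>.\<close>

lemma square_dist:
  assumes "(a, b) \<in> square" "z \<notin> square"
  shows "1 \<le> 2 * (inverse (1 - a ^ 2) + inverse (1 - b ^ 2)) * dist (a, b) z"
proof -
  have ab: "\<bar>a\<bar> < 1" "\<bar>b\<bar> < 1" using assms by (auto simp: square_def)
  then have ab2: "a ^ 2 < 1" "b ^ 2 < 1" by (auto simp: abs_square_less_1)
  have half: "1 - t ^ 2 \<le> 2 - 2 * \<bar>t\<bar>" for t :: real
    using zero_le_power2[of "1 - \<bar>t\<bar>"] by (simp add: power2_diff)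
  have "\<bar>a - fst z\<bar> \<le> dist (a, b) z" "\<bar>b - snd z\<bar> \<le> dist (a, b) z"
    using dist_fst_le[of "(a,b)" z] dist_snd_le[of "(a,b)" z] by (auto simp: dist_real_def)
  then have "1 - \<bar>a\<bar> \<le> dist (a, b) z \<or> 1 - \<bar>b\<bar> \<le> dist (a, b) z"
    using assms(2) by (auto simp: square_def)
  then have "1 - a ^ 2 \<le> 2 * dist (a, b) z \<or> 1 - b ^ 2 \<le> 2 * dist (a, b) z"
    using half[of a] half[of b] by (smt (verit))
  from \<open>1 - a ^ 2 \<le> 2 * dist (a, b) z \<or> 1 - b ^ 2 \<le> 2 * dist (a, b) z\<close>
  show ?thesis
  proof
    assume "1 - a ^ 2 \<le> 2 * dist (a, b) z"
    then have "1 \<le> inverse (1 - a ^ 2) * (2 * dist (a, b) z)"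
      using ab2 by (simp add: inverse_eq_divide pos_le_divide_eq)
    also have "\<dots> \<le> (inverse (1 - a ^ 2) + inverse (1 - b ^ 2)) * (2 * dist (a, b) z)"
      using ab2 by (intro mult_right_mono) auto
    finally show ?thesis by (simp only: mult_ac)
  next
    assume "1 - b ^ 2 \<le> 2 * dist (a, b) z"
    then have "1 \<le> inverse (1 - b ^ 2) * (2 * dist (a, b) z)"
      using ab2 by (simp add: inverse_eq_divide pos_le_divide_eq)
    also have "\<dots> \<le> (inverse (1 - a ^ 2) + inverse (1 - b ^ 2)) * (2 * dist (a, b) z)"
      using ab2 by (intro mult_right_mono) auto
    finally show ?thesis by (simp only: mult_ac)
  qed
qed

section \<open>Half-strip, square and disc\<close>

lemma half_strip_to_square: "tempered_map half_strip square (\<lambda>z. (2 / fst z - 1, 2 * snd z - 1))"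
proof (rule tempered_map_Pair)
  let ?h = "\<lambda>z. 2 * (fst z ^ 2 * inverse (fst z - 1) + inverse (snd z) * inverse (1 - snd z)) :: real"
  show "tempered half_strip ?h"
    by (intro tempered_intros half_strip_tempered)
  have "smooth_tempered half_strip (\<lambda>z. 2 / fst z)"
    by (intro smooth_tempered_divide smooth_tempered_intros half_strip_tempered open_half_strip)
      (auto simp: half_strip_def)
  then show "smooth_tempered half_strip (\<lambda>z. 2 / fst z - 1)" by (intro smooth_tempered_intros)
  show "smooth_tempered half_strip (\<lambda>z. 2 * snd z - 1)" by (intro smooth_tempered_intros)
  show mem: "(2 / fst z - 1, 2 * snd z - 1) \<in> square" if "z \<in> half_strip" for z
    using that by (auto simp: half_strip_def square_def abs_less_iff field_simps)
  show "square \<noteq> UNIV" by (rule square_neq_UNIV)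
  show "1 \<le> ?h z * dist (2 / fst z - 1, 2 * snd z - 1) w" if z: "z \<in> half_strip" and w: "w \<notin> square" for z w
  proof -
    have pos: "1 < fst z" "0 < snd z" "snd z < 1" using z by (auto simp: half_strip_def)
    \<comment> \<open>The slack tends to zero at \<open>fst z = 1\<close> and also as
      \<open>fst z\<close> grows, since the end at infinity is carried to an edge of the square;
      hence the two factors of the bound below.\<close>
    have "1 - (2 / fst z - 1) ^ 2 = 4 * (fst z - 1) / fst z ^ 2"
      using pos by (simp add: field_simps power2_eq_square)
    then have i1: "inverse (1 - (2 / fst z - 1) ^ 2) \<le> fst z ^ 2 * inverse (fst z - 1)"
      using pos by (simp add: divide_simps)
    have "1 - (2 * snd z - 1) ^ 2 = 4 * (snd z * (1 - snd z))"
      by (simp add: algebra_simps power2_eq_square)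
    then have i2: "inverse (1 - (2 * snd z - 1) ^ 2) \<le> inverse (snd z) * inverse (1 - snd z)"
      using pos by (simp add: divide_simps)
    have "2 * (inverse (1 - (2 / fst z - 1) ^ 2) + inverse (1 - (2 * snd z - 1) ^ 2)) *
        dist (2 / fst z - 1, 2 * snd z - 1) w \<le> ?h z * dist (2 / fst z - 1, 2 * snd z - 1) w"
      using i1 i2 by (intro mult_right_mono mult_left_mono add_mono) auto
    then show ?thesis using square_dist[OF mem[OF z] w] by linarith
  qed
qed

lemma square_to_half_strip: "tempered_map square half_strip (\<lambda>z. (2 / (1 + fst z), (1 + snd z) / 2))"
proof (rule tempered_map_Pair)
  let ?h = "\<lambda>z. (1 + fst z) * inverse (1 - fst z) + 2 * inverse (1 + snd z) + 2 * inverse (1 - snd z) :: real"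
  show "tempered square ?h"
    by (intro tempered_intros square_tempered)
  show "smooth_tempered square (\<lambda>z. 2 / (1 + fst z))"
    by (intro smooth_tempered_divide smooth_tempered_intros square_tempered open_square)
      (auto simp: square_def)
  show "smooth_tempered square (\<lambda>z. (1 + snd z) / 2)"
    by (intro smooth_tempered_divide smooth_tempered_intros tempered_intros open_square) auto
  show mem: "(2 / (1 + fst z), (1 + snd z) / 2) \<in> half_strip" if "z \<in> square" for z
    using that by (auto simp: half_strip_def square_def abs_less_iff field_simps)
  show "half_strip \<noteq> UNIV" by (rule half_strip_neq_UNIV)
  show "1 \<le> ?h z * dist (2 / (1 + fst z), (1 + snd z) / 2) w" if z: "z \<in> square" and w: "w \<notin> half_strip" for z w
  proof -
    have pos: "-1 < fst z" "fst z < 1" "-1 < snd z" "snd z < 1" using z by (auto simp: square_def)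
    have "inverse (2 / (1 + fst z) - 1) = (1 + fst z) * inverse (1 - fst z)"
      "inverse ((1 + snd z) / 2) = 2 * inverse (1 + snd z)"
      "inverse (1 - (1 + snd z) / 2) = 2 * inverse (1 - snd z)"
      using pos by (simp_all add: divide_simps)
    then show ?thesis using half_strip_dist[OF mem[OF z] w] by simp
  qed
qed

lemma half_strip_square_inverse:
  "z \<in> half_strip \<Longrightarrow> (\<lambda>z. (2 / (1 + fst z), (1 + snd z) / 2)) (2 / fst z - 1, 2 * snd z - 1) = z"
  by (cases z) (auto simp: half_strip_def)

lemma square_half_strip_inverse:
  "z \<in> square \<Longrightarrow> (\<lambda>z. (2 / fst z - 1, 2 * snd z - 1)) (2 / (1 + fst z), (1 + snd z) / 2) = z"
  by (cases z) (auto simp: square_def add_divide_distrib)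

lemma tempered_equivalent_half_strip_square: "tempered_equivalent half_strip square"
  by (rule tempered_equivalentI[OF half_strip_to_square square_to_half_strip
      half_strip_square_inverse square_half_strip_inverse])

section \<open>The disc\<close>

lemma norm_real_pair: "norm (z :: real \<times> real) ^ 2 = fst z ^ 2 + snd z ^ 2"
  by (cases z) (simp add: norm_Pair)

lemma mem_disc_iff: "z \<in> ball 0 1 \<longleftrightarrow> fst z ^ 2 + snd z ^ 2 < (1::real)"
proof -
  have "z \<in> ball 0 1 \<longleftrightarrow> norm z ^ 2 < 1" using abs_square_less_1[of "norm z"] by simp
  then show ?thesis by (simp only: norm_real_pair)
qed

lemma disc_tempered:
  "tempered (ball 0 1) (\<lambda>z. inverse (1 - fst z ^ 2 - snd z ^ 2) :: real)"
  "tempered (ball 0 1) (\<lambda>z :: real \<times> real. inverse (1 - fst z ^ 2))"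
  "tempered (ball 0 1) (\<lambda>z :: real \<times> real. inverse (1 - snd z ^ 2))"
proof -
  have "\<exists>w. w \<notin> ball 0 1 \<and> dist z w \<le> 1 - norm z" if z: "z \<in> ball 0 1" for z :: "real \<times> real"
  \<comment> \<open>Away from the centre the radial projection is the nearest point of the circle;
    at the centre any unit vector is.\<close>
  proof (cases "z = 0")
    case True
    then show ?thesis by (intro exI[of _ "(1,0)"]) (simp add: norm_Pair)
  next
    case False
    have "dist z (z /\<^sub>R norm z) = norm ((1 - inverse (norm z)) *\<^sub>R z)"
      by (simp add: dist_norm scaleR_left_diff_distrib)
    also have "\<dots> = \<bar>1 - inverse (norm z)\<bar> * norm z" by simp
    also have "\<dots> = 1 - norm z" using z False by (simp add: divide_simps abs_if)
    finally show ?thesis using False by (intro exI[of _ "z /\<^sub>R norm z"]) simp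
  qed
  then have "tempered (ball 0 1) (\<lambda>z::real \<times> real. inverse (1 - norm z))"
    by (intro tempered_inverse) auto
  then show 1: "tempered (ball 0 1) (\<lambda>z. inverse (1 - fst z ^ 2 - snd z ^ 2) :: real)"
  proof (rule tempered_mono)
    fix z :: "real \<times> real" assume "z \<in> ball 0 1"
    then have n: "norm z < 1" by simp
    have eq: "1 - fst z ^ 2 - snd z ^ 2 = 1 - norm z ^ 2" by (simp add: norm_real_pair)
    have "norm z ^ 2 \<le> norm z" using n by (simp add: power2_eq_square mult_left_le)
    then show "\<bar>inverse (1 - fst z ^ 2 - snd z ^ 2)\<bar> \<le> \<bar>inverse (1 - norm z)\<bar>"
      unfolding eq using n by (auto intro!: le_imp_inverse_le)
  qed
  show "tempered (ball 0 1) (\<lambda>z :: real \<times> real. inverse (1 - fst z ^ 2))"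
    "tempered (ball 0 1) (\<lambda>z :: real \<times> real. inverse (1 - snd z ^ 2))"
  proof -
    have le: "\<bar>inverse a\<bar> \<le> \<bar>inverse b\<bar>" if "0 < b" "b \<le> a" for a b :: real
      using that le_imp_inverse_le[of b a] by simp
    have p: "0 < 1 - fst z ^ 2 - snd z ^ 2" if "z \<in> ball 0 1" for z :: "real \<times> real"
      using that unfolding mem_disc_iff by linarith
    show "tempered (ball 0 1) (\<lambda>z :: real \<times> real. inverse (1 - fst z ^ 2))"
    proof (rule tempered_mono[OF 1])
      show "\<bar>inverse (1 - fst z ^ 2)\<bar> \<le> \<bar>inverse (1 - fst z ^ 2 - snd z ^ 2)\<bar>"
        if "z \<in> ball 0 1" for z :: "real \<times> real"
        using p[OF that] by (intro le) simp_all
    qed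
    show "tempered (ball 0 1) (\<lambda>z :: real \<times> real. inverse (1 - snd z ^ 2))"
    proof (rule tempered_mono[OF 1])
      show "\<bar>inverse (1 - snd z ^ 2)\<bar> \<le> \<bar>inverse (1 - fst z ^ 2 - snd z ^ 2)\<bar>"
        if "z \<in> ball 0 1" for z :: "real \<times> real"
        using p[OF that] by (intro le) simp_all
    qed
  qed
qed

lemma disc_dist:
  fixes a b :: real
  assumes "(a, b) \<in> ball 0 1" "z \<notin> ball 0 1"
  shows "1 \<le> 2 * inverse (1 - a ^ 2 - b ^ 2) * dist (a, b) z"
proof -
  let ?r = "norm (a, b)"
  have r: "?r < 1" "1 \<le> norm z" using assms by auto
  have "norm z \<le> ?r + dist (a, b) z"
    using norm_triangle_sub[of z "(a, b)"] by (simp add: dist_norm norm_minus_commute)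
  moreover have "1 - ?r ^ 2 \<le> 2 - 2 * ?r"
    using zero_le_power2[of "1 - ?r"] by (simp add: power2_diff)
  ultimately have "1 - ?r ^ 2 \<le> 2 * dist (a, b) z" using r by linarith
  moreover have eq: "?r ^ 2 = a ^ 2 + b ^ 2" by (simp add: norm_Pair)
  moreover have "0 < 1 - ?r ^ 2" using r abs_square_less_1[of ?r] by simp
  ultimately show ?thesis by (simp add: divide_simps)
qed

text \<open>The map \<open>t \<mapsto> t / sqrt (1 - t\<^sup>2)\<close> on each coordinate, from the square to the plane,
  followed by \<open>z \<mapsto> z / sqrt (1 + norm z ^ 2)\<close>, from the plane to the disc.\<close>

lemma square_to_disc:
  "tempered_map square (ball 0 1) (\<lambda>z.
     (fst z * sqrt ((1 - snd z ^ 2) / (1 - fst z ^ 2 * snd z ^ 2)),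
      snd z * sqrt ((1 - fst z ^ 2) / (1 - fst z ^ 2 * snd z ^ 2))))" (is "tempered_map _ _ (\<lambda>z. (?f z, ?g z))")
proof (rule tempered_map_Pair)
  have sq: "fst z ^ 2 < 1" "snd z ^ 2 < 1" "fst z ^ 2 * snd z ^ 2 < 1" if "z \<in> square" for z
  proof -
    show "fst z ^ 2 < 1" "snd z ^ 2 < 1" using that by (auto simp: square_def abs_square_less_1)
    moreover from this have "fst z ^ 2 * snd z ^ 2 \<le> fst z ^ 2" by (intro mult_left_le) auto
    ultimately show "fst z ^ 2 * snd z ^ 2 < 1" by linarith
  qed
  have nz: "fst z ^ 2 * snd z ^ 2 \<noteq> 1" if "z \<in> square" for z
    using sq(3)[OF that] by simp
  let ?h = "\<lambda>z. 2 * ((1 - fst z ^ 2 * snd z ^ 2) * (inverse (1 - fst z ^ 2) * inverse (1 - snd z ^ 2))) :: real"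
  have m1: "tempered square (\<lambda>z. 1 - fst z ^ 2 * snd z ^ 2)"
    by (intro smooth_tempered_tempered smooth_tempered_intros)
  show "tempered square ?h"
    by (intro tempered_mult tempered_const m1 square_tempered_squares)
  \<comment> \<open>With \<open>(x, y)\<close> the intermediate point of the plane, this is
    \<open>1 / (1 + x ^ 2 + y ^ 2)\<close>. Its factorization into the slacks of the square gives
    both membership in the disc and the bound \<open>?h\<close>.\<close>
  have eq: "1 - ?f z ^ 2 - ?g z ^ 2 = (1 - fst z ^ 2) * (1 - snd z ^ 2) / (1 - fst z ^ 2 * snd z ^ 2)"
    if "z \<in> square" for z
  proof -
    have "?f z ^ 2 = fst z ^ 2 * (1 - snd z ^ 2) / (1 - fst z ^ 2 * snd z ^ 2)"
      "?g z ^ 2 = snd z ^ 2 * (1 - fst z ^ 2) / (1 - fst z ^ 2 * snd z ^ 2)"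
      using sq[OF that] by (simp_all add: power_mult_distrib)
    then show ?thesis using sq[OF that] by (simp add: divide_simps) (simp add: algebra_simps)
  qed
  show "smooth_tempered square ?f"
    by (intro smooth_tempered_sqrt smooth_tempered_divide smooth_tempered_intros square_tempered_squares open_square)
      (use sq nz in \<open>auto simp: inverse_divide divide_inverse intro!: tempered_mult m1 square_tempered_squares\<close>)
  show "smooth_tempered square ?g"
    by (intro smooth_tempered_sqrt smooth_tempered_divide smooth_tempered_intros square_tempered_squares open_square)
      (use sq nz in \<open>auto simp: inverse_divide divide_inverse intro!: tempered_mult m1 square_tempered_squares\<close>)
  show mem: "(?f z, ?g z) \<in> ball 0 1" if "z \<in> square" for z
  proof -
    have "0 < 1 - ?f z ^ 2 - ?g z ^ 2" unfolding eq[OF that] using sq[OF that] by simp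
    then show ?thesis unfolding mem_disc_iff fst_conv snd_conv by linarith
  qed
  show "ball 0 1 \<noteq> (UNIV :: (real \<times> real) set)"
    using bounded_ball[of 0 1] not_bounded_UNIV by metis
  show "1 \<le> ?h z * dist (?f z, ?g z) w" if z: "z \<in> square" and w: "w \<notin> ball 0 1" for z w
    using disc_dist[OF mem[OF z] w] sq[OF z] unfolding eq[OF z] by (simp add: divide_inverse mult_ac)
qed

text \<open>The two steps undone: \<open>z / sqrt (1 - norm z ^ 2)\<close> leads to the plane, then
  \<open>t / sqrt (1 + t ^ 2)\<close> acts on each coordinate. The factor
  \<open>1 - norm z ^ 2\<close> cancels, leaving only the square of the other coordinate under each
  root.\<close>

lemma disc_to_square:
  "tempered_map (ball 0 1) square (\<lambda>z.
     (fst z * sqrt (1 / (1 - snd z ^ 2)), snd z * sqrt (1 / (1 - fst z ^ 2))))" (is "tempered_map _ _ (\<lambda>z. (?f z, ?g z))")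
proof (rule tempered_map_Pair)
  have sq: "0 < 1 - fst z ^ 2 - snd z ^ 2" "fst z ^ 2 < 1" "snd z ^ 2 < 1" if "z \<in> ball 0 1" for z :: "real \<times> real"
  proof -
    show "0 < 1 - fst z ^ 2 - snd z ^ 2" using that unfolding mem_disc_iff by linarith
    then show "fst z ^ 2 < 1" "snd z ^ 2 < 1"
      using zero_le_power2[of "fst z"] zero_le_power2[of "snd z"] by linarith+
  qed
  have nz: "fst z ^ 2 \<noteq> 1" "snd z ^ 2 \<noteq> 1" if "z \<in> ball 0 1" for z :: "real \<times> real"
    using sq[OF that] by simp_all
  let ?h = "\<lambda>z. 2 * (inverse (1 - fst z ^ 2 - snd z ^ 2) * (1 - snd z ^ 2) +
      inverse (1 - fst z ^ 2 - snd z ^ 2) * (1 - fst z ^ 2)) :: real"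
  have m1: "tempered (ball 0 1) (\<lambda>z :: real \<times> real. 1 - fst z ^ 2)"
    "tempered (ball 0 1) (\<lambda>z :: real \<times> real. 1 - snd z ^ 2)"
    by (intro smooth_tempered_tempered smooth_tempered_intros)+
  show "tempered (ball 0 1) ?h"
    by (intro tempered_mult tempered_add tempered_const m1 disc_tempered)
  have eq: "1 - ?f z ^ 2 = (1 - fst z ^ 2 - snd z ^ 2) / (1 - snd z ^ 2)"
    "1 - ?g z ^ 2 = (1 - fst z ^ 2 - snd z ^ 2) / (1 - fst z ^ 2)" if "z \<in> ball 0 1" for z
    using sq[OF that] by (simp_all add: power_mult_distrib divide_simps)
  show "smooth_tempered (ball 0 1) ?f"
    by (intro smooth_tempered_sqrt smooth_tempered_divide smooth_tempered_intros disc_tempered open_ball)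
      (use sq m1 nz in \<open>auto simp del: mem_ball_0\<close>)
  show "smooth_tempered (ball 0 1) ?g"
    by (intro smooth_tempered_sqrt smooth_tempered_divide smooth_tempered_intros disc_tempered open_ball)
      (use sq m1 nz in \<open>auto simp del: mem_ball_0\<close>)
  show mem: "(?f z, ?g z) \<in> square" if "z \<in> ball 0 1" for z
  proof -
    have "0 < 1 - ?f z ^ 2" "0 < 1 - ?g z ^ 2" unfolding eq[OF that] using sq[OF that] by simp_all
    then show ?thesis by (simp add: square_def abs_square_less_1)
  qed
  show "square \<noteq> UNIV" by (rule square_neq_UNIV)
  show "1 \<le> ?h z * dist (?f z, ?g z) w" if z: "z \<in> ball 0 1" and w: "w \<notin> square" for z w
    using square_dist[OF mem[OF z] w] unfolding eq[OF z] by (simp add: divide_inverse)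
qed

lemma square_disc_inverse:
  assumes "z \<in> square"
  shows "(\<lambda>z. (fst z * sqrt (1 / (1 - snd z ^ 2)), snd z * sqrt (1 / (1 - fst z ^ 2))))
    (fst z * sqrt ((1 - snd z ^ 2) / (1 - fst z ^ 2 * snd z ^ 2)),
      snd z * sqrt ((1 - fst z ^ 2) / (1 - fst z ^ 2 * snd z ^ 2))) = z"
proof -
  \<comment> \<open>All radicands are rational in the squares of the coordinates; in each coordinate
    the product of the two radicands is one.\<close>
  define a b where "a = fst z ^ 2" and "b = snd z ^ 2"
  have ab: "0 \<le> a" "a < 1" "0 \<le> b" "b < 1" using assms by (auto simp: a_def b_def square_def abs_square_less_1)
  moreover have "a * b \<le> a" using ab by (intro mult_left_le) auto
  ultimately have c: "a * b < 1" by linarith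
  have "1 - b * ((1 - a) / (1 - a * b)) = (1 - b) / (1 - a * b)"
    "1 - a * ((1 - b) / (1 - a * b)) = (1 - a) / (1 - a * b)"
    using c by (simp_all add: field_simps)
  then show ?thesis
    using ab c unfolding a_def[symmetric] b_def[symmetric]
    by (intro prod_eqI) (simp_all add: power_mult_distrib a_def[symmetric] b_def[symmetric]
        real_sqrt_mult[symmetric] mult.assoc del: real_sqrt_divide)
qed

lemma disc_square_inverse:
  assumes "z \<in> ball 0 1"
  shows "(\<lambda>z. (fst z * sqrt ((1 - snd z ^ 2) / (1 - fst z ^ 2 * snd z ^ 2)),
      snd z * sqrt ((1 - fst z ^ 2) / (1 - fst z ^ 2 * snd z ^ 2))))
    (fst z * sqrt (1 / (1 - snd z ^ 2)), snd z * sqrt (1 / (1 - fst z ^ 2))) = z"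
proof -
  define a b where "a = fst z ^ 2" and "b = snd z ^ 2"
  have ab: "0 \<le> a" "0 \<le> b" "a + b < 1" using assms unfolding mem_disc_iff by (auto simp: a_def b_def)
  then have c: "a < 1" "b < 1" by linarith+
  have "(1 - b * (1 / (1 - a))) / (1 - a * (1 / (1 - b)) * (b * (1 / (1 - a)))) = 1 - b"
    "(1 - a * (1 / (1 - b))) / (1 - a * (1 / (1 - b)) * (b * (1 / (1 - a)))) = 1 - a"
  proof -
    have d: "1 - a * (1 / (1 - b)) * (b * (1 / (1 - a))) = (1 - a - b) / ((1 - a) * (1 - b))"
      using c by (simp add: divide_simps) (simp add: algebra_simps)
    have e: "1 - b * (1 / (1 - a)) = (1 - a - b) / (1 - a)" "1 - a * (1 / (1 - b)) = (1 - a - b) / (1 - b)"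
      using c by (simp_all add: field_simps)
    show "(1 - b * (1 / (1 - a))) / (1 - a * (1 / (1 - b)) * (b * (1 / (1 - a)))) = 1 - b"
      "(1 - a * (1 / (1 - b))) / (1 - a * (1 / (1 - b)) * (b * (1 / (1 - a)))) = 1 - a"
      unfolding d e using ab c by simp_all
  qed
  then show ?thesis
    using ab c unfolding a_def[symmetric] b_def[symmetric]
    by (intro prod_eqI) (simp_all add: power_mult_distrib a_def[symmetric] b_def[symmetric]
        real_sqrt_mult[symmetric] mult.assoc del: real_sqrt_divide)
qed

lemma tempered_equivalent_square_disc: "tempered_equivalent square (ball (0 :: real \<times> real) 1)"
  by (rule tempered_equivalentI[OF square_to_disc disc_to_square
      square_disc_inverse disc_square_inverse])

section \<open>The cusp\<close>

text \<open>Beyond some \<open>M\<close> the polynomial is at least its leading coefficient, and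
  compactness covers the rest. The hypotheses speak of the coefficient at \<open>n\<close> because
  \<open>q\<close> will be a sum or difference of polynomials, whose degree would first have to be
  found.\<close>

lemma poly_bounded_below:
  fixes q :: "real poly"
  assumes "degree q \<le> n" "0 < coeff q n"
  obtains C where "0 \<le> C" "\<And>u. 0 \<le> u \<Longrightarrow> - C \<le> poly q u"
proof -
  have "degree q = n" using assms by (metis le_antisym le_degree less_irrefl)
  then obtain M where M: "\<And>u. M \<le> u \<Longrightarrow> lead_coeff q \<le> poly q u"
    using poly_pinfty_gt_lc[of q] assms by auto
  have "compact (poly q ` {0..M})"
    by (intro compact_continuous_image continuous_intros) auto
  then obtain B where B: "\<And>y. y \<in> poly q ` {0..M} \<Longrightarrow> norm y \<le> B"
    using compact_imp_bounded bounded_iff by metis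
  show thesis
  proof (rule that[of "\<bar>B\<bar>"])
    fix u :: real assume u: "0 \<le> u"
    show "- \<bar>B\<bar> \<le> poly q u"
    proof (cases "u \<le> M")
      case True
      then show ?thesis using B[of "poly q u"] u by auto
    next
      case False
      then show ?thesis using M[of u] assms \<open>degree q = n\<close> by auto
    qed
  qed simp
qed

lemma coeff_one_plus_X_power: "coeff ([:1, 1:] ^ n) n = (1::real)" "degree ([:1, 1:] ^ n :: real poly) = n"
  using coeff_linear_power[of "1::real" n] degree_linear_power[of "1::real" n] by auto

lemma poly_one_plus_X_power: "poly ([:1, 1:] ^ n) u = (1 + u :: real) ^ n"
  by (simp add: poly_power)

text \<open>To be applied with \<open>a = 1 + u\<close> and \<open>a ^ n = 1 + ln x\<close>: it
  keeps the inverse coordinate \<open>u\<close> from tending to zero faster than a multiple of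
  \<open>ln x\<close>.\<close>

lemma power_diff_le:
  fixes a :: real
  assumes "1 \<le> a"
  shows "a ^ n - 1 \<le> real n * (a - 1) * a ^ n"
proof (induction n)
  case (Suc n)
  have "a ^ Suc n - 1 = a * (a ^ n - 1) + (a - 1) * 1" by (simp add: algebra_simps)
  also have "\<dots> \<le> a * (real n * (a - 1) * a ^ n) + (a - 1) * a ^ Suc n"
    using assms Suc one_le_power[of a "Suc n"] by (intro add_mono mult_left_mono) auto
  also have "\<dots> = real (Suc n) * (a - 1) * a ^ Suc n" by (simp add: algebra_simps)
  finally show ?case .
qed simp

text \<open>The inverse of \<open>u \<mapsto> exp ((1 + u)\<^sup>n - 1)\<close>, a diffeomorphism from the positive
  half-line to the half-line above 1. Unlike \<open>exp \<circ> poly p\<close> it is monotone for every \<open>p\<close> of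
  degree \<open>n\<close>, while the two are bounded by constant multiples of powers of each other.\<close>

definition cusp_coord :: "nat \<Rightarrow> real \<Rightarrow> real" where
  "cusp_coord n x = (1 + ln x) powr (1 / real n) - 1"

definition cusp :: "real poly \<Rightarrow> (real \<times> real) set" where
  "cusp p = {z. 0 < fst z \<and> 0 < snd z \<and> snd z < exp (- poly p (fst z))}"

lemma open_cusp: "open (cusp p)"
  unfolding cusp_def
  by (intro open_Collect_conj open_Collect_less continuous_intros)

lemma cusp_neq_UNIV: "cusp p \<noteq> UNIV"
proof -
  have "(0, 0) \<notin> cusp p" by (simp add: cusp_def)
  then show ?thesis by blast
qed

lemma cusp_tempered:
  "tempered (cusp p) (\<lambda>z. inverse (fst z))"
  "tempered (cusp p) (\<lambda>z. inverse (snd z))"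
  "tempered (cusp p) (\<lambda>z. inverse (exp (- poly p (fst z)) - snd z))"
proof -
  have "\<exists>w. w \<notin> cusp p \<and> dist z w \<le> fst z" if "z \<in> cusp p" for z
    by (rule exI[of _ "(0, snd z)"]) (use that in \<open>auto simp: cusp_def dist_prod_def dist_real_def\<close>)
  then show "tempered (cusp p) (\<lambda>z. inverse (fst z))"
    by (intro tempered_inverse open_cusp) (auto simp: cusp_def)
  have "\<exists>w. w \<notin> cusp p \<and> dist z w \<le> snd z" if "z \<in> cusp p" for z
    by (rule exI[of _ "(fst z, 0)"]) (use that in \<open>auto simp: cusp_def dist_prod_def dist_real_def\<close>)
  then show "tempered (cusp p) (\<lambda>z. inverse (snd z))"
    by (intro tempered_inverse open_cusp) (auto simp: cusp_def)
  have "\<exists>w. w \<notin> cusp p \<and> dist z w \<le> exp (- poly p (fst z)) - snd z" if "z \<in> cusp p" for z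
    by (rule exI[of _ "(fst z, exp (- poly p (fst z)))"])
      (use that in \<open>auto simp: cusp_def dist_prod_def dist_real_def\<close>)
  then show "tempered (cusp p) (\<lambda>z. inverse (exp (- poly p (fst z)) - snd z))"
    by (intro tempered_inverse open_cusp) (auto simp: cusp_def)
qed

section \<open>Growth of the polynomial and the maps between cusp and half-strip\<close>

context
  fixes p :: "real poly" and n :: nat
  assumes n: "n = degree p" "0 < n" and lc: "0 < lead_coeff p"
begin

lemma poly_ge_minus: obtains C where "0 \<le> C" "\<And>u. 0 \<le> u \<Longrightarrow> - C \<le> poly p u"
  by (rule poly_bounded_below[of p n]) (use n lc in auto)

text \<open>The multiplier is a natural number so that it becomes the exponent of an ordinary power
  once \<open>exp\<close> is applied. Being larger than \<open>1 / lead_coeff p\<close>, it makes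
  the top coefficient of the difference positive.\<close>

lemma power_le_poly:
  obtains C k where "0 \<le> C" "\<And>u. 0 \<le> u \<Longrightarrow> (1 + u) ^ n \<le> C + real k * poly p u"
proof -
  obtain k :: nat where "1 / lead_coeff p < real k" using reals_Archimedean2 by blast
  then have k: "1 < real k * lead_coeff p" using lc by (simp add: divide_simps)
  obtain C where C: "0 \<le> C" "\<And>u. 0 \<le> u \<Longrightarrow> - C \<le> poly (smult (real k) p - [:1, 1:] ^ n) u"
    by (rule poly_bounded_below[of "smult (real k) p - [:1, 1:] ^ n" n])
      (use n k in \<open>auto simp: coeff_one_plus_X_power intro!: degree_diff_le\<close>)
  have "(1 + u) ^ n \<le> C + real k * poly p u" if "0 \<le> u" for u
    using C(2)[OF that] by (simp add: poly_one_plus_X_power)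
  then show thesis using that C(1) by blast
qed

lemma poly_le_power:
  obtains C k where "0 \<le> C" "\<And>u. 0 \<le> u \<Longrightarrow> poly p u \<le> C + real k * (1 + u) ^ n"
proof -
  obtain k :: nat where k: "lead_coeff p < real k" using reals_Archimedean2 by blast
  obtain C where C: "0 \<le> C" "\<And>u. 0 \<le> u \<Longrightarrow> - C \<le> poly (smult (real k) ([:1, 1:] ^ n) - p) u"
    by (rule poly_bounded_below[of "smult (real k) ([:1, 1:] ^ n) - p" n])
      (use n k in \<open>auto simp: coeff_one_plus_X_power intro!: degree_diff_le\<close>)
  have "poly p u \<le> C + real k * (1 + u) ^ n" if "0 \<le> u" for u
    using C(2)[OF that] by (simp add: poly_one_plus_X_power)
  then show thesis using that C(1) by blast
qed

text \<open>The derivative has degree below \<open>n\<close>, so adding or subtracting it leaves the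
  top coefficient of \<open>[:1, 1:] ^ n\<close> equal to one; the two signs give the absolute
  value.\<close>

lemma abs_pderiv_le_power:
  obtains C where "0 \<le> C" "\<And>u. 0 \<le> u \<Longrightarrow> \<bar>poly (pderiv p) u\<bar> \<le> C + (1 + u) ^ n"
proof -
  have d: "degree (pderiv p) < n" using n by (simp add: degree_pderiv)
  obtain C where C: "0 \<le> C" "\<And>u. 0 \<le> u \<Longrightarrow> - C \<le> poly ([:1, 1:] ^ n - pderiv p) u"
    by (rule poly_bounded_below[of "[:1, 1:] ^ n - pderiv p" n])
      (use d in \<open>auto simp: coeff_one_plus_X_power coeff_eq_0 intro!: degree_diff_le\<close>)
  obtain C' where C': "0 \<le> C'" "\<And>u. 0 \<le> u \<Longrightarrow> - C' \<le> poly ([:1, 1:] ^ n + pderiv p) u"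
    by (rule poly_bounded_below[of "[:1, 1:] ^ n + pderiv p" n])
      (use d in \<open>auto simp: coeff_one_plus_X_power coeff_eq_0 intro!: degree_add_le\<close>)
  have "\<bar>poly (pderiv p) u\<bar> \<le> max C C' + (1 + u) ^ n" if "0 \<le> u" for u
    using C(2)[OF that] C'(2)[OF that] by (simp add: poly_one_plus_X_power)
  then show thesis using that[of "max C C'"] C(1) by auto
qed

text \<open>The derivative is bounded on the half-line: \<open>\<bar>poly (pderiv p) u\<bar>\<close>
  is at most a constant plus a multiple of \<open>poly p u\<close>, and
  \<open>t * exp (- t) \<le> 1\<close>.\<close>

lemma exp_minus_poly_lipschitz:
  obtains L where "0 \<le> L" "\<And>u u'. 0 \<le> u \<Longrightarrow> 0 \<le> u' \<Longrightarrow>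
    \<bar>exp (- poly p u) - exp (- poly p u')\<bar> \<le> L * \<bar>u - u'\<bar>"
proof -
  obtain C0 where C0: "0 \<le> C0" "\<And>u. 0 \<le> u \<Longrightarrow> - C0 \<le> poly p u" by (rule poly_ge_minus) blast
  obtain C1 k where C1: "0 \<le> C1" "\<And>u. 0 \<le> u \<Longrightarrow> (1 + u) ^ n \<le> C1 + real k * poly p u"
    by (rule power_le_poly) blast
  obtain C3 where C3: "0 \<le> C3" "\<And>u. 0 \<le> u \<Longrightarrow> \<bar>poly (pderiv p) u\<bar> \<le> C3 + (1 + u) ^ n"
    by (rule abs_pderiv_le_power) blast
  define L where "L = (C3 + C1) * exp C0 + real k"
  have bound: "norm (exp (- poly p u) * - poly (pderiv p) u) \<le> L" if u: "u \<in> {0..}" for u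
  proof -
    have "exp (- poly p u) \<le> exp C0" using C0(2)[of u] u by simp
    moreover have "poly p u \<le> exp (poly p u)" using exp_ge_add_one_self[of "poly p u"] by linarith
    then have "poly p u * exp (- poly p u) \<le> exp (poly p u) * exp (- poly p u)"
      by (intro mult_right_mono) auto
    then have pe: "poly p u * exp (- poly p u) \<le> 1" by (simp add: exp_minus)
    have "norm (exp (- poly p u) * - poly (pderiv p) u) = \<bar>poly (pderiv p) u\<bar> * exp (- poly p u)"
      by (simp add: abs_mult)
    also have "\<dots> \<le> (C3 + C1 + real k * poly p u) * exp (- poly p u)"
      using C1(2)[of u] C3(2)[of u] u by (intro mult_right_mono) auto
    also have "\<dots> = (C3 + C1) * exp (- poly p u) + real k * (poly p u * exp (- poly p u))"
      by (simp add: algebra_simps)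
    also have "\<dots> \<le> (C3 + C1) * exp C0 + real k * 1"
      using C1(1) C3(1) pe calculation \<open>exp (- poly p u) \<le> exp C0\<close> by (intro add_mono mult_left_mono) auto
    finally show ?thesis by (simp add: L_def)
  qed
  have "norm (exp (- poly p u) - exp (- poly p u')) \<le> L * norm (u - u')"
    if "0 \<le> u" "0 \<le> u'" for u u'
    by (rule field_differentiable_bound[where S="{0..}" and f'="\<lambda>u. exp (- poly p u) * - poly (pderiv p) u"])
      (use that bound in \<open>auto intro!: derivative_eq_intros simp del: norm_mult\<close>)
  moreover have "0 \<le> L" unfolding L_def using C0 C1(1) C3(1) by simp
  ultimately show thesis using that[of L] by simp
qed

text \<open>The third slack is a vertical gap below a graph. Moving by a distance \<open>d\<close>
  changes the height of the graph by at most \<open>L * d\<close> and \<open>v\<close> by at most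
  \<open>d\<close>, whence the factor \<open>1 + L\<close>.\<close>

lemma cusp_dist:
  obtains K where "\<And>u v z. (u, v) \<in> cusp p \<Longrightarrow> z \<notin> cusp p \<Longrightarrow>
    1 \<le> K * (inverse u + inverse v + inverse (exp (- poly p u) - v)) * dist (u, v) z"
proof -
  obtain L where L: "0 \<le> L" "\<And>u u'. 0 \<le> u \<Longrightarrow> 0 \<le> u' \<Longrightarrow>
    \<bar>exp (- poly p u) - exp (- poly p u')\<bar> \<le> L * \<bar>u - u'\<bar>" by (rule exp_minus_poly_lipschitz) blast
  have "1 \<le> (1 + L) * (inverse u + inverse v + inverse (exp (- poly p u) - v)) * dist (u, v) z"
    if uv: "(u, v) \<in> cusp p" and z: "z \<notin> cusp p" for u v z
  proof -
    let ?d = "dist (u, v) z"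
    have d: "\<bar>u - fst z\<bar> \<le> ?d" "\<bar>v - snd z\<bar> \<le> ?d"
      using dist_fst_le[of "(u,v)" z] dist_snd_le[of "(u,v)" z] by (auto simp: dist_real_def)
    have d1: "?d \<le> (1 + L) * ?d" using L(1) by (simp add: distrib_right)
    have "1 \<le> (inverse u + inverse v + inverse (exp (- poly p u) - v)) * ((1 + L) * ?d)"
    proof (rule one_le_sum_inverse_mult)
      consider "fst z \<le> 0" | "snd z \<le> 0" | "0 < fst z" "exp (- poly p (fst z)) \<le> snd z"
        using z by (cases "fst z \<le> 0"; cases "snd z \<le> 0") (auto simp: cusp_def not_less not_le)
      then show "u \<le> (1 + L) * ?d \<or> v \<le> (1 + L) * ?d \<or> exp (- poly p u) - v \<le> (1 + L) * ?d"
      proof cases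
        case 3
        have "L * \<bar>u - fst z\<bar> \<le> L * ?d" using d L(1) by (intro mult_left_mono)
        then have "exp (- poly p u) - exp (- poly p (fst z)) \<le> L * ?d"
          using L(2)[of u "fst z"] 3 uv by (simp add: cusp_def)
        then have "exp (- poly p u) - v \<le> L * ?d + ?d" using 3 d by linarith
        then show ?thesis by (simp add: distrib_right)
      qed (use d d1 in linarith)+
    qed (use uv in \<open>auto simp: cusp_def\<close>)
    then show ?thesis by (simp only: mult_ac)
  qed
  then show thesis using that by blast
qed

lemma tempered_exp_minus_poly:
  assumes "\<And>x. x \<in> U \<Longrightarrow> 0 \<le> f x"
  shows "tempered U (\<lambda>x. exp (- poly p (f x)))"
proof -
  obtain C where C: "\<And>u. 0 \<le> u \<Longrightarrow> - C \<le> poly p u" using poly_ge_minus by blast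
  show ?thesis
    by (rule tempered_mono[OF tempered_const[of _ "exp C"]]) (use C assms in force)
qed

lemma cusp_to_half_strip:
  "tempered_map (cusp p) half_strip (\<lambda>z. (exp ((1 + fst z) ^ n - 1), snd z * exp (poly p (fst z))))"
proof (rule tempered_map_Pair)
  have ge: "fst z \<le> (1 + fst z) ^ n - 1" if "z \<in> cusp p" for z
    using self_le_power[of "1 + fst z" n] n that by (simp add: cusp_def)
  have ge': "fst z \<le> exp ((1 + fst z) ^ n - 1) - 1" if "z \<in> cusp p" for z
    using ge[OF that] exp_ge_add_one_self[of "(1 + fst z) ^ n - 1"] by linarith
  have lt: "snd z * exp (poly p (fst z)) < 1" if "z \<in> cusp p" for z
    using that by (simp add: cusp_def exp_minus field_simps)
  \<comment> \<open>Membership gives \<open>exp (poly p u) < inverse v\<close>, and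
    \<open>inverse v\<close> is dominated by the weight.\<close>
  have ep: "tempered (cusp p) (\<lambda>z. exp (poly p (fst z)))"
  proof (rule tempered_mono[OF cusp_tempered(2)])
    fix z assume "z \<in> cusp p"
    with lt[OF this] show "\<bar>exp (poly p (fst z))\<bar> \<le> \<bar>inverse (snd z)\<bar>"
      by (simp add: cusp_def inverse_eq_divide pos_le_divide_eq mult.commute)
  qed
  obtain C k where C: "\<And>u. 0 \<le> u \<Longrightarrow> (1 + u) ^ n \<le> C + real k * poly p u"
    using power_le_poly by blast
  \<comment> \<open>The first coordinate is at most a constant times a power of the factor just
    estimated.\<close>
  have ex: "tempered (cusp p) (\<lambda>z. exp ((1 + fst z) ^ n - 1))"
  proof (rule tempered_mono[OF tempered_mult[OF tempered_const[of _ "exp C"] tempered_power[OF ep, of k]]])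
    fix z assume "z \<in> cusp p"
    then have "(1 + fst z) ^ n - 1 \<le> C + real k * poly p (fst z)" using C[of "fst z"] by (simp add: cusp_def)
    then have "exp ((1 + fst z) ^ n - 1) \<le> exp (C + real k * poly p (fst z))" by simp
    then show "\<bar>exp ((1 + fst z) ^ n - 1)\<bar> \<le> \<bar>exp C * exp (poly p (fst z)) ^ k\<bar>"
      by (simp add: exp_add exp_of_nat_mult abs_mult)
  qed
  show "smooth_tempered (cusp p) (\<lambda>z. exp ((1 + fst z) ^ n - 1))"
    by (intro smooth_tempered_exp smooth_tempered_intros open_cusp ex)
  show "smooth_tempered (cusp p) (\<lambda>z. snd z * exp (poly p (fst z)))"
    by (intro smooth_tempered_mult smooth_tempered_exp smooth_tempered_intros open_cusp ep)
  \<comment> \<open>Bounds for the reciprocals of the three slacks of the half-strip at the image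
    point; the first rests on \<open>exp ((1 + u) ^ n - 1) - 1 \<ge> u\<close>.\<close>
  let ?h = "\<lambda>z. inverse (fst z) + inverse (snd z) * exp (- poly p (fst z)) +
     exp (- poly p (fst z)) * inverse (exp (- poly p (fst z)) - snd z)"
  show "tempered (cusp p) ?h"
    by (intro tempered_add tempered_mult cusp_tempered tempered_exp_minus_poly) (auto simp: cusp_def)
  show mem: "(exp ((1 + fst z) ^ n - 1), snd z * exp (poly p (fst z))) \<in> half_strip" if "z \<in> cusp p" for z
    using ge[OF that] lt[OF that] that by (simp add: half_strip_def cusp_def)
  show "half_strip \<noteq> UNIV" by (rule half_strip_neq_UNIV)
  show "1 \<le> ?h z * dist (exp ((1 + fst z) ^ n - 1), snd z * exp (poly p (fst z))) w"
    if z: "z \<in> cusp p" and w: "w \<notin> half_strip" for z w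
  proof -
    let ?x = "exp ((1 + fst z) ^ n - 1)" and ?y = "snd z * exp (poly p (fst z))"
    have pos: "0 < fst z" "0 < snd z" using z by (auto simp: cusp_def)
    have "inverse (?x - 1) \<le> inverse (fst z)" using ge'[OF z] pos by (intro le_imp_inverse_le)
    moreover have "inverse ?y = inverse (snd z) * exp (- poly p (fst z))" by (simp add: exp_minus)
    moreover have "1 - ?y = exp (poly p (fst z)) * (exp (- poly p (fst z)) - snd z)"
      by (simp add: algebra_simps exp_minus)
    then have "inverse (1 - ?y) = exp (- poly p (fst z)) * inverse (exp (- poly p (fst z)) - snd z)"
      by (simp add: exp_minus)
    ultimately have "(inverse (?x - 1) + inverse ?y + inverse (1 - ?y)) * dist (?x, ?y) w \<le> ?h z * dist (?x, ?y) w"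
      by (intro mult_right_mono) auto
    then show ?thesis using half_strip_dist[OF mem[OF z] w] by linarith
  qed
qed

lemma cusp_coord:
  assumes "1 < x"
  shows "0 < cusp_coord n x" "(1 + cusp_coord n x) ^ n = 1 + ln x"
proof -
  have l: "0 < ln x" using assms by simp
  have "1 powr (1 / real n) < (1 + ln x) powr (1 / real n)"
    using l n by (intro powr_less_mono2) auto
  then show "0 < cusp_coord n x" by (simp add: cusp_coord_def)
  show "(1 + cusp_coord n x) ^ n = 1 + ln x"
    using l n(2) by (simp add: cusp_coord_def powr_power)
qed

lemma half_strip_to_cusp:
  "tempered_map half_strip (cusp p)
     (\<lambda>z. (cusp_coord n (fst z), snd z * exp (- poly p (cusp_coord n (fst z)))))"
proof -
  obtain K where K: "\<And>u v z. (u, v) \<in> cusp p \<Longrightarrow> z \<notin> cusp p \<Longrightarrow>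
    1 \<le> K * (inverse u + inverse v + inverse (exp (- poly p u) - v)) * dist (u, v) z"
    using cusp_dist by blast
  show ?thesis
  proof (rule tempered_map_Pair)
    have pos: "1 < fst z" "0 < snd z" "snd z < 1" "0 < ln (fst z)" if "z \<in> half_strip" for z
      using that by (auto simp: half_strip_def)
    have stu: "smooth_tempered half_strip (\<lambda>z. cusp_coord n (fst z))"
    proof -
      have "smooth_tempered half_strip (\<lambda>z. ln (fst z))"
        by (rule smooth_tempered_ln[OF open_half_strip smooth_tempered_fst half_strip_tempered(4)])
          (simp add: half_strip_def)
      then have ln: "smooth_tempered half_strip (\<lambda>z. 1 + ln (fst z))"
        by (rule smooth_tempered_add[OF smooth_tempered_const])
      \<comment> \<open>The root is taken of numbers above one, away from its singularity at
        zero.\<close>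
      have "tempered half_strip (\<lambda>z. inverse (1 + ln (fst z)))"
      proof (rule tempered_mono[OF tempered_const[of _ 1]])
        show "\<bar>inverse (1 + ln (fst z))\<bar> \<le> \<bar>1\<bar>" if "z \<in> half_strip" for z
          using pos(4)[OF that] by (simp add: inverse_le_1_iff)
      qed
      then have "smooth_tempered half_strip (\<lambda>z. (1 + ln (fst z)) powr (1 / real n))"
      proof (rule smooth_tempered_powr[OF open_half_strip ln])
        show "0 < 1 + ln (fst z)" if "z \<in> half_strip" for z using pos(4)[OF that] by simp
      qed (use n(2) in simp_all)
      then show ?thesis unfolding cusp_coord_def by (intro smooth_tempered_diff smooth_tempered_const)
    qed
    then show "smooth_tempered half_strip (\<lambda>z. cusp_coord n (fst z))" .
    have em: "tempered half_strip (\<lambda>z. exp (- poly p (cusp_coord n (fst z))))"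
      using cusp_coord(1) pos by (intro tempered_exp_minus_poly) (auto intro: less_imp_le)
    show "smooth_tempered half_strip (\<lambda>z. snd z * exp (- poly p (cusp_coord n (fst z))))"
      by (intro smooth_tempered_mult smooth_tempered_snd smooth_tempered_exp smooth_tempered_minus
          smooth_tempered_poly stu em open_half_strip)
    \<comment> \<open>In the new coordinate \<open>(1 + u) ^ n = 1 + ln x\<close>, so exponentiating
      this bound gives a constant times \<open>x ^ k\<close>.\<close>
    obtain C k where C: "\<And>u. 0 \<le> u \<Longrightarrow> poly p u \<le> C + real k * (1 + u) ^ n"
      using poly_le_power by blast
    have ep: "tempered half_strip (\<lambda>z. exp (poly p (cusp_coord n (fst z))))"
    proof (rule tempered_mono[OF tempered_mult[OF tempered_const[of _ "exp (C + real k)"]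
            tempered_power[OF smooth_tempered_tempered[OF smooth_tempered_fst], where k=k]]])
      fix z assume z: "z \<in> half_strip"
      have "poly p (cusp_coord n (fst z)) \<le> C + real k * (1 + ln (fst z))"
        using C[of "cusp_coord n (fst z)"] cusp_coord[OF pos(1)[OF z]] by simp
      then have "exp (poly p (cusp_coord n (fst z))) \<le> exp ((C + real k) + real k * ln (fst z))"
        by (simp add: algebra_simps)
      then show "\<bar>exp (poly p (cusp_coord n (fst z)))\<bar> \<le> \<bar>exp (C + real k) * fst z ^ k\<bar>"
        using pos[OF z] by (simp add: exp_add[of "C + real k"] exp_of_nat_mult abs_mult)
    qed
    let ?u = "\<lambda>z. cusp_coord n (fst z)"
    \<comment> \<open>\<open>\<bar>K\<bar>\<close> because the sign of \<open>K\<close> is not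
      known. The three terms bound the reciprocal slacks of the cusp at the image point.\<close>
    let ?h = "\<lambda>z. \<bar>K\<bar> * (real n * fst z ^ 2 * inverse (fst z - 1) + inverse (snd z) * exp (poly p (?u z)) +
        exp (poly p (?u z)) * inverse (1 - snd z))"
    show "tempered half_strip ?h"
      by (intro tempered_intros half_strip_tempered ep)
    show mem: "(?u z, snd z * exp (- poly p (?u z))) \<in> cusp p" if "z \<in> half_strip" for z
      using pos[OF that] cusp_coord(1) by (simp add: cusp_def)
    show "cusp p \<noteq> UNIV" by (rule cusp_neq_UNIV)
    show "1 \<le> ?h z * dist (?u z, snd z * exp (- poly p (?u z))) w"
      if z: "z \<in> half_strip" and w: "w \<notin> cusp p" for z w
    proof -
      let ?v = "snd z * exp (- poly p (?u z))"
      have u0: "0 < ?u z" using cusp_coord(1) pos[OF z] by blast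
      have x: "1 < fst z" using pos[OF z] by blast
      \<comment> \<open>Lower bound for \<open>u\<close>, critical near the edge
        \<open>x = 1\<close>: from \<open>1 - 1 / x \<le> ln x \<le> n * u * x\<close> follows
        \<open>x - 1 \<le> n * x ^ 2 * u\<close>.\<close>
      have "ln (fst z) \<le> real n * ?u z * (1 + ln (fst z))"
        using power_diff_le[of "1 + ?u z" n] cusp_coord[OF x] by simp
      also have "\<dots> \<le> real n * ?u z * fst z"
        using ln_le_minus_one[of "fst z"] x u0 by (intro mult_left_mono) auto
      finally have l: "ln (fst z) \<le> real n * ?u z * fst z" .
      have "1 - inverse (fst z) \<le> ln (fst z)"
        using ln_le_minus_one[of "inverse (fst z)"] x by (simp add: ln_inverse)
      then have "fst z * (1 - inverse (fst z)) \<le> fst z * (real n * ?u z * fst z)"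
        using l x by (intro mult_left_mono) auto
      then have "fst z - 1 \<le> real n * fst z ^ 2 * ?u z"
        using x by (simp add: right_diff_distrib power2_eq_square mult_ac)
      then have i1: "inverse (?u z) \<le> real n * fst z ^ 2 * inverse (fst z - 1)"
        using u0 x by (simp add: inverse_eq_divide divide_simps mult_ac)
      have i2: "inverse ?v = inverse (snd z) * exp (poly p (?u z))" by (simp add: exp_minus)
      have "exp (- poly p (?u z)) - ?v = exp (- poly p (?u z)) * (1 - snd z)" by (simp add: algebra_simps)
      then have i3: "inverse (exp (- poly p (?u z)) - ?v) = exp (poly p (?u z)) * inverse (1 - snd z)"
        by (simp add: exp_minus)
      have nn: "0 \<le> inverse (?u z) + inverse ?v + inverse (exp (- poly p (?u z)) - ?v)"
        unfolding i2 i3 using u0 pos[OF z] by (intro add_nonneg_nonneg mult_nonneg_nonneg) auto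
      have "1 \<le> K * (inverse (?u z) + inverse ?v + inverse (exp (- poly p (?u z)) - ?v)) * dist (?u z, ?v) w"
        by (rule K[OF mem[OF z] w])
      also have "\<dots> \<le> ?h z * dist (?u z, ?v) w"
      proof (intro mult_right_mono mult_mono)
        show "inverse (?u z) + inverse ?v + inverse (exp (- poly p (?u z)) - ?v) \<le>
          real n * fst z ^ 2 * inverse (fst z - 1) + inverse (snd z) * exp (poly p (?u z)) +
          exp (poly p (?u z)) * inverse (1 - snd z)"
          unfolding i2 i3 using i1 by simp
      qed (use nn in auto)
      finally show ?thesis .
    qed
  qed
qed

lemma cusp_half_strip_inverse:
  assumes "z \<in> cusp p"
  shows "(\<lambda>z. (cusp_coord n (fst z), snd z * exp (- poly p (cusp_coord n (fst z)))))
    (exp ((1 + fst z) ^ n - 1), snd z * exp (poly p (fst z))) = z"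
proof -
  have "0 < fst z" using assms by (simp add: cusp_def)
  then have "cusp_coord n (exp ((1 + fst z) ^ n - 1)) = fst z"
    using n(2) by (simp add: cusp_coord_def powr_powr flip: powr_realpow)
  then show ?thesis by (intro prod_eqI) (simp_all add: exp_minus)
qed

lemma half_strip_cusp_inverse:
  assumes "z \<in> half_strip"
  shows "(\<lambda>z. (exp ((1 + fst z) ^ n - 1), snd z * exp (poly p (fst z))))
    (cusp_coord n (fst z), snd z * exp (- poly p (cusp_coord n (fst z)))) = z"
  using assms cusp_coord(2)[of "fst z"] by (intro prod_eqI) (simp_all add: exp_minus half_strip_def)

lemma tempered_equivalent_cusp_half_strip: "tempered_equivalent (cusp p) half_strip"
  by (rule tempered_equivalentI[OF cusp_to_half_strip half_strip_to_cusp
      cusp_half_strip_inverse half_strip_cusp_inverse])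

end

theorem mainTheorem10:
  fixes p :: "real poly"
  assumes "degree p > 0"
    and "lead_coeff p > 0"
  shows "schwartz_equivalent
           {(u::real, v::real). 0 < u \<and> 0 < v \<and> v < exp (- poly p u)}
           {(x::real, y::real). 1 < x \<and> 0 < y \<and> y < 1} \<and>
         schwartz_equivalent
           {(u::real, v::real). 0 < u \<and> 0 < v \<and> v < exp (- poly p u)}
           (ball 0 1)"
proof -
  have cusp: "{(u::real, v::real). 0 < u \<and> 0 < v \<and> v < exp (- poly p u)} = cusp p"
    by (auto simp: cusp_def)
  have strip: "{(x::real, y::real). 1 < x \<and> 0 < y \<and> y < 1} = half_strip"
    by (auto simp: half_strip_def)
  have disc: "ball 0 1 \<noteq> (UNIV :: (real \<times> real) set)"
    using bounded_ball[of 0 1] not_bounded_UNIV by metis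
  have equiv: "tempered_equivalent (cusp p) half_strip"
    using assms by (intro tempered_equivalent_cusp_half_strip) auto
  have "tempered_equivalent (cusp p) (ball (0 :: real \<times> real) 1)"
    using equiv tempered_equivalent_half_strip_square tempered_equivalent_square_disc
    by (blast intro: tempered_equivalent_trans)
  with equiv show ?thesis unfolding cusp strip
    by (intro conjI schwartz_equivalent_if_tempered_equivalent open_cusp cusp_neq_UNIV
        open_half_strip half_strip_neq_UNIV open_ball disc)
qed

end
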